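(* Let $V$ be a vector space over a field $\mathbb{K}$ and let $*$ be a bilinear product on $V$, extended to $T(V)$ as described in the context, with associated product $\circledast$. 1. The Hopf algebras $(T(V),\circledast,\Delta_{sh})$ and $(T(V),\cdot,\Delta_{sh})$ (where $\cdot$ is concatenation) are isomorphic, via the algebra morphism $$\phi_*:(T(V),\cdot,\Delta_{sh})\longrightarrow(T(V),\circledast,\Delta_{sh}),\qquad x_1\ldots x_k\in V^{\otimes k}\longmapsto x_1\circledast\ldots\circledast x_k.$$ 2. $\mathcal{L}ie(V)*T(V)\subseteq \mathcal{L}ie(V)$. Moreover $(\mathcal{L}ie(V),[-,-],* )$ is a post-Lie algebra, where $[f,g]=fg-gf$. Its second Lie bracket is denoted by $\{-,-\}_*$: $$\forall f,g\in\mathcal{L}ie(V),\quad \{f,g\}_*=[f,g]+f*g-g*f=fg-gf+f*g-g*f.$$ The Lie algebra $(\mathcal{L}ie(V),\{-,-\}_* )$ is isomorphic to the Lie algebra $(\mathcal{L}ie(V),[-,-])$.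
   Context: $T(V)$ is the tensor algebra with concatenation product (written by juxtaposition) and unit $1$; $\Delta_{sh}$ is the cocommutative deshuffling coproduct, the algebra morphism (for concatenation) with $\Delta_{sh}(x)=x\otimes 1+1\otimes x$ for $x\in V$, with counit $\varepsilon$ ($\varepsilon(1)=1$, $\varepsilon(V^{\otimes n})=0$ for $n\geq 1$). Sweedler notation: $\Delta_{sh}(h)=\sum h^{(1)}\otimes h^{(2)}$. $\mathcal{L}ie(V)\subseteq T(V)$ is the free Lie algebra generated by $V$, i.e. the Lie subalgebra of $T(V)$ (for $[f,g]=fg-gf$) generated by $V$. Extension of $*$: a bilinear product $*$ on $V$ extends uniquely to a bilinear map $T(V)\otimes T(V)\to T(V)$ such that for all $f,g,h\in T(V)$, $x,y\in V$: $f*1=f$; $1*f=\varepsilon(f)1$; $x*(fy)=(x*f)*y-x*(f*y)$; $(fg)*h=\sum (f*h^{(1)})(g*h^{(2)})$. The product $\circledast$ on $T(V)$ is $f\circledast g=\sum (f*g^{(1)})g^{(2)}$; $(T(V),\circledast,\Delta_{sh})$ is a Hopf algebra. A (right) post-Lie algebra is a triple $(\mathfrak{g},\{-,-\},* )$ where $(\mathfrak{g},\{-,-\})$ is a Lie algebra and $*$ is a bilinear product on $\mathfrak{g}$ such that for all $x,y,z\in\mathfrak{g}$: $x*\{y,z\}=(x*y)*z-x*(y*z)-(x*z)*y+x*(z*y)$ and $\{x,y\}*z=\{x*z,y\}+\{x,y*z\}$. On any post-Lie algebra, $\{x,y\}_*=\{x,y\}+x*y-y*x$ is a second Lie bracket.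 *)

theory Defs
  imports Complex_Main "HOL-Library.Poly_Mapping"
begin

text \<open>The type \<open>'x \<Rightarrow>\<^sub>0 'k\<close> is used as the free vector space on the set of all elements
  of \<open>'x\<close>.\<close>

definition fscale :: "'k::field \<Rightarrow> ('x \<Rightarrow>\<^sub>0 'k) \<Rightarrow> ('x \<Rightarrow>\<^sub>0 'k)" where
  "fscale c p = Poly_Mapping.map ((*) c) p"

lemma lookup_fscale: "Poly_Mapping.lookup (fscale c p) x = c * Poly_Mapping.lookup p x"
  unfolding fscale_def by (simp add: Poly_Mapping.map.rep_eq when_def)

lemma vector_space_fscale: "vector_space fscale"
  by (unfold_locales; rule poly_mapping_eqI)
     (simp_all add: lookup_fscale Poly_Mapping.lookup_add algebra_simps)

definition lin_ext ::
    "('k::field \<Rightarrow> 'b::ab_group_add \<Rightarrow> 'b) \<Rightarrow> ('x \<Rightarrow> 'b) \<Rightarrow> ('x \<Rightarrow>\<^sub>0 'k) \<Rightarrow> 'b" where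
  "lin_ext s f p = (\<Sum>x\<in>Poly_Mapping.keys p. s (Poly_Mapping.lookup p x) (f x))"

definition bilinear_map ::
    "('k::field \<Rightarrow> 'a::ab_group_add \<Rightarrow> 'a) \<Rightarrow> ('k \<Rightarrow> 'b::ab_group_add \<Rightarrow> 'b) \<Rightarrow>
     ('k \<Rightarrow> 'c::ab_group_add \<Rightarrow> 'c) \<Rightarrow> ('a \<Rightarrow> 'b \<Rightarrow> 'c) \<Rightarrow> bool" where
  "bilinear_map s1 s2 s3 f \<longleftrightarrow>
     (\<forall>x. Vector_Spaces.linear s2 s3 (f x)) \<and> (\<forall>y. Vector_Spaces.linear s1 s3 (\<lambda>x. f x y))"

text \<open>For a vector space \<open>V\<close> with scalar multiplication \<open>s\<close>, the direct sum of all tensor powers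
  of \<open>V\<close> is the free vector space on the set of all words (lists) over \<open>V\<close> modulo the subspace
  spanned by the multilinearity relations. The word \<open>[x1, ..., xn]\<close> stands for the pure tensor of
  \<open>x1, ..., xn\<close>. The relations preserve length, so the words of length \<open>n\<close> yield exactly the
  \<open>n\<close>-th tensor power.\<close>

definition multilinear_relations ::
    "('k::field \<Rightarrow> 'v::ab_group_add \<Rightarrow> 'v) \<Rightarrow> ('v list \<Rightarrow>\<^sub>0 'k) set" where
  "multilinear_relations s = module.span fscale
     ({Poly_Mapping.single (u @ (x + y) # w) 1 - Poly_Mapping.single (u @ x # w) 1
         - Poly_Mapping.single (u @ y # w) 1 | u w x y. True} \<union>
      {Poly_Mapping.single (u @ s c x # w) 1 - Poly_Mapping.single (u @ x # w) c
         | u w c x. True})"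

definition tensor_eq ::
    "('k::field \<Rightarrow> 'v::ab_group_add \<Rightarrow> 'v) \<Rightarrow> ('v list \<Rightarrow>\<^sub>0 'k) \<Rightarrow> ('v list \<Rightarrow>\<^sub>0 'k) \<Rightarrow> bool" where
  "tensor_eq s p q \<longleftrightarrow> p - q \<in> multilinear_relations s"

text \<open>\<open>A\<close> with \<open>\<iota> : V \<rightarrow> A\<close> is the tensor algebra of \<open>V\<close> iff the linear map sending
  the word \<open>[x1, ..., xn]\<close> to the product \<open>\<iota> x1 \<cdots> \<iota> xn\<close> induces a bijection from the quotient
  described above onto \<open>A\<close>. Concatenation is the multiplication of the ring \<open>'a\<close>.\<close>

locale tensor_algebra = V: vector_space sV + T: vector_space sT
  for sV :: "'k::field \<Rightarrow> 'v::ab_group_add \<Rightarrow> 'v"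
    and sT :: "'k \<Rightarrow> 'a::ring_1 \<Rightarrow> 'a" +
  fixes \<iota> :: "'v \<Rightarrow> 'a"
  assumes times_bilinear: "bilinear_map sT sT sT (*)"
    and words_surj: "surj (lin_ext sT (\<lambda>xs. prod_list (map \<iota> xs)))"
    and words_eq_iff: "lin_ext sT (\<lambda>xs. prod_list (map \<iota> xs)) p
         = lin_ext sT (\<lambda>xs. prod_list (map \<iota> xs)) q \<longleftrightarrow> tensor_eq sV p q"

text \<open>An element of \<open>A \<otimes> A\<close> or \<open>A \<otimes> A \<otimes> A\<close> is represented by a formal combination of
  words of length 2 or 3 over \<open>A\<close>, and equality there is \<open>tensor_eq\<close>. A coproduct \<open>\<Delta>\<close> is thus
  given by a choice of representatives \<open>\<Sum> h\<^sup>1 \<otimes> h\<^sup>2\<close> of \<open>\<Delta>(h)\<close>.\<close>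

abbreviation tens2 :: "'a \<Rightarrow> 'a \<Rightarrow> 'a list \<Rightarrow>\<^sub>0 'k::field" where
  "tens2 a b \<equiv> Poly_Mapping.single [a, b] 1"

abbreviation tens3 :: "'a \<Rightarrow> 'a \<Rightarrow> 'a \<Rightarrow> 'a list \<Rightarrow>\<^sub>0 'k::field" where
  "tens3 a b c \<equiv> Poly_Mapping.single [a, b, c] 1"

text \<open>\<open>sweedler s F (\<Delta> h)\<close> is \<open>\<Sum> F h\<^sup>1 h\<^sup>2\<close>, where \<open>s\<close> is the scalar multiplication
  of the codomain of \<open>F\<close>.\<close>

definition sweedler ::
    "('k::field \<Rightarrow> 'b::ab_group_add \<Rightarrow> 'b) \<Rightarrow> ('a \<Rightarrow> 'a \<Rightarrow> 'b) \<Rightarrow> ('a list \<Rightarrow>\<^sub>0 'k) \<Rightarrow> 'b" where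
  "sweedler s F = lin_ext s (\<lambda>w. F (w ! 0) (w ! 1))"

definition tens_mult ::
    "('a \<Rightarrow> 'a \<Rightarrow> 'a) \<Rightarrow> ('a list \<Rightarrow>\<^sub>0 'k::field) \<Rightarrow> ('a list \<Rightarrow>\<^sub>0 'k) \<Rightarrow> ('a list \<Rightarrow>\<^sub>0 'k)" where
  "tens_mult m p q =
     sweedler fscale (\<lambda>a b. sweedler fscale (\<lambda>c d. tens2 (m a c) (m b d)) q) p"

definition linear_into_tens2 ::
    "('k::field \<Rightarrow> 'a::ab_group_add \<Rightarrow> 'a) \<Rightarrow> ('a \<Rightarrow> ('a list \<Rightarrow>\<^sub>0 'k)) \<Rightarrow> bool" where
  "linear_into_tens2 s \<Delta> \<longleftrightarrow>
     (\<forall>f. \<forall>w\<in>Poly_Mapping.keys (\<Delta> f). length w = 2) \<and>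
     (\<forall>f g. tensor_eq s (\<Delta> (f + g)) (\<Delta> f + \<Delta> g)) \<and>
     (\<forall>c f. tensor_eq s (\<Delta> (s c f)) (fscale c (\<Delta> f)))"

definition algebra_over ::
    "('k::field \<Rightarrow> 'a::ab_group_add \<Rightarrow> 'a) \<Rightarrow> ('a \<Rightarrow> 'a \<Rightarrow> 'a) \<Rightarrow> 'a \<Rightarrow> bool" where
  "algebra_over s m u \<longleftrightarrow> vector_space s \<and> bilinear_map s s s m \<and>
     (\<forall>f g h. m (m f g) h = m f (m g h)) \<and> (\<forall>f. m u f = f \<and> m f u = f)"

definition coalgebra_over ::
    "('k::field \<Rightarrow> 'a::ab_group_add \<Rightarrow> 'a) \<Rightarrow> ('a \<Rightarrow> ('a list \<Rightarrow>\<^sub>0 'k)) \<Rightarrow> ('a \<Rightarrow> 'k) \<Rightarrow> bool" where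
  "coalgebra_over s \<Delta> \<epsilon> \<longleftrightarrow> vector_space s \<and> linear_into_tens2 s \<Delta> \<and>
     Vector_Spaces.linear s (*) \<epsilon> \<and>
     (\<forall>h. tensor_eq s
        (sweedler fscale (\<lambda>a b. sweedler fscale (\<lambda>a1 a2. tens3 a1 a2 b) (\<Delta> a)) (\<Delta> h))
        (sweedler fscale (\<lambda>a b. sweedler fscale (\<lambda>b1 b2. tens3 a b1 b2) (\<Delta> b)) (\<Delta> h))) \<and>
     (\<forall>h. sweedler s (\<lambda>a b. s (\<epsilon> a) b) (\<Delta> h) = h) \<and>
     (\<forall>h. sweedler s (\<lambda>a b. s (\<epsilon> b) a) (\<Delta> h) = h)"

definition hopf_algebra ::
    "('k::field \<Rightarrow> 'a::ab_group_add \<Rightarrow> 'a) \<Rightarrow> ('a \<Rightarrow> 'a \<Rightarrow> 'a) \<Rightarrow> 'a \<Rightarrow>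
     ('a \<Rightarrow> ('a list \<Rightarrow>\<^sub>0 'k)) \<Rightarrow> ('a \<Rightarrow> 'k) \<Rightarrow> bool" where
  "hopf_algebra s m u \<Delta> \<epsilon> \<longleftrightarrow> algebra_over s m u \<and> coalgebra_over s \<Delta> \<epsilon> \<and>
     (\<forall>f g. tensor_eq s (\<Delta> (m f g)) (tens_mult m (\<Delta> f) (\<Delta> g))) \<and>
     tensor_eq s (\<Delta> u) (tens2 u u) \<and>
     (\<forall>f g. \<epsilon> (m f g) = \<epsilon> f * \<epsilon> g) \<and> \<epsilon> u = 1 \<and>
     (\<exists>S. Vector_Spaces.linear s s S \<and>
       (\<forall>h. sweedler s (\<lambda>a b. m (S a) b) (\<Delta> h) = s (\<epsilon> h) u \<and>
            sweedler s (\<lambda>a b. m a (S b)) (\<Delta> h) = s (\<epsilon> h) u))"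

text \<open>Compatibility with the antipodes is automatic for a morphism of bialgebras.\<close>

definition hopf_isomorphism ::
    "('k::field \<Rightarrow> 'a::ab_group_add \<Rightarrow> 'a) \<Rightarrow> ('a \<Rightarrow> 'a \<Rightarrow> 'a) \<Rightarrow> 'a \<Rightarrow>
     ('a \<Rightarrow> ('a list \<Rightarrow>\<^sub>0 'k)) \<Rightarrow> ('a \<Rightarrow> 'k) \<Rightarrow>
     ('k \<Rightarrow> 'b::ab_group_add \<Rightarrow> 'b) \<Rightarrow> ('b \<Rightarrow> 'b \<Rightarrow> 'b) \<Rightarrow> 'b \<Rightarrow>
     ('b \<Rightarrow> ('b list \<Rightarrow>\<^sub>0 'k)) \<Rightarrow> ('b \<Rightarrow> 'k) \<Rightarrow> ('a \<Rightarrow> 'b) \<Rightarrow> bool" where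
  "hopf_isomorphism s m u \<Delta> \<epsilon> s' m' u' \<Delta>' \<epsilon>' \<phi> \<longleftrightarrow>
     hopf_algebra s m u \<Delta> \<epsilon> \<and> hopf_algebra s' m' u' \<Delta>' \<epsilon>' \<and>
     Vector_Spaces.linear s s' \<phi> \<and> bij \<phi> \<and>
     (\<forall>f g. \<phi> (m f g) = m' (\<phi> f) (\<phi> g)) \<and> \<phi> u = u' \<and>
     (\<forall>h. tensor_eq s' (\<Delta>' (\<phi> h)) (sweedler fscale (\<lambda>a b. tens2 (\<phi> a) (\<phi> b)) (\<Delta> h))) \<and>
     (\<forall>h. \<epsilon>' (\<phi> h) = \<epsilon> h)"

definition deshuffling_coproduct ::
    "('k::field \<Rightarrow> 'a::ring_1 \<Rightarrow> 'a) \<Rightarrow> ('v \<Rightarrow> 'a) \<Rightarrow> ('a \<Rightarrow> ('a list \<Rightarrow>\<^sub>0 'k)) \<Rightarrow> bool" where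
  "deshuffling_coproduct s \<iota> \<Delta> \<longleftrightarrow> linear_into_tens2 s \<Delta> \<and>
     (\<forall>f g. tensor_eq s (\<Delta> (f * g)) (tens_mult (*) (\<Delta> f) (\<Delta> g))) \<and>
     tensor_eq s (\<Delta> 1) (tens2 1 1) \<and>
     (\<forall>x. tensor_eq s (\<Delta> (\<iota> x)) (tens2 (\<iota> x) 1 + tens2 1 (\<iota> x)))"

definition deshuffling_counit ::
    "('k::field \<Rightarrow> 'a::ring_1 \<Rightarrow> 'a) \<Rightarrow> ('v \<Rightarrow> 'a) \<Rightarrow> ('a \<Rightarrow> 'k) \<Rightarrow> bool" where
  "deshuffling_counit s \<iota> \<epsilon> \<longleftrightarrow> Vector_Spaces.linear s (*) \<epsilon> \<and> \<epsilon> 1 = 1 \<and>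
     (\<forall>xs. xs \<noteq> [] \<longrightarrow> \<epsilon> (prod_list (map \<iota> xs)) = 0)"

definition star_extension ::
    "('k::field \<Rightarrow> 'a::ring_1 \<Rightarrow> 'a) \<Rightarrow> ('v \<Rightarrow> 'a) \<Rightarrow> ('a \<Rightarrow> ('a list \<Rightarrow>\<^sub>0 'k)) \<Rightarrow> ('a \<Rightarrow> 'k) \<Rightarrow>
     ('v \<Rightarrow> 'v \<Rightarrow> 'v) \<Rightarrow> ('a \<Rightarrow> 'a \<Rightarrow> 'a) \<Rightarrow> bool" where
  "star_extension s \<iota> \<Delta> \<epsilon> starV star \<longleftrightarrow> bilinear_map s s s star \<and>
     (\<forall>x y. star (\<iota> x) (\<iota> y) = \<iota> (starV x y)) \<and>
     (\<forall>f. star f 1 = f) \<and>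
     (\<forall>f. star 1 f = s (\<epsilon> f) 1) \<and>
     (\<forall>x f y. star (\<iota> x) (f * \<iota> y) = star (star (\<iota> x) f) (\<iota> y) - star (\<iota> x) (star f (\<iota> y))) \<and>
     (\<forall>f g h. star (f * g) h = sweedler s (\<lambda>a b. star f a * star g b) (\<Delta> h))"

definition circ_product ::
    "('k::field \<Rightarrow> 'a::ring_1 \<Rightarrow> 'a) \<Rightarrow> ('a \<Rightarrow> ('a list \<Rightarrow>\<^sub>0 'k)) \<Rightarrow> ('a \<Rightarrow> 'a \<Rightarrow> 'a) \<Rightarrow>
     'a \<Rightarrow> 'a \<Rightarrow> 'a" where
  "circ_product s \<Delta> star f g = sweedler s (\<lambda>a b. star f a * b) (\<Delta> g)"

definition commutator :: "'a::ring_1 \<Rightarrow> 'a \<Rightarrow> 'a" where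
  "commutator f g = f * g - g * f"

definition free_lie :: "('k::field \<Rightarrow> 'a::ring_1 \<Rightarrow> 'a) \<Rightarrow> ('v \<Rightarrow> 'a) \<Rightarrow> 'a set" where
  "free_lie s \<iota> = \<Inter>{L. module.subspace s L \<and> range \<iota> \<subseteq> L \<and>
                       (\<forall>f\<in>L. \<forall>g\<in>L. commutator f g \<in> L)}"

definition bilinear_product_on ::
    "('k::field \<Rightarrow> 'a::ab_group_add \<Rightarrow> 'a) \<Rightarrow> 'a set \<Rightarrow> ('a \<Rightarrow> 'a \<Rightarrow> 'a) \<Rightarrow> bool" where
  "bilinear_product_on s L m \<longleftrightarrow>
     (\<forall>x\<in>L. \<forall>y\<in>L. m x y \<in> L) \<and>
     (\<forall>x\<in>L. \<forall>y\<in>L. \<forall>z\<in>L. m (x + y) z = m x z + m y z \<and> m x (y + z) = m x y + m x z) \<and>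
     (\<forall>c. \<forall>x\<in>L. \<forall>y\<in>L. m (s c x) y = s c (m x y) \<and> m x (s c y) = s c (m x y))"

definition lie_algebra_on ::
    "('k::field \<Rightarrow> 'a::ab_group_add \<Rightarrow> 'a) \<Rightarrow> 'a set \<Rightarrow> ('a \<Rightarrow> 'a \<Rightarrow> 'a) \<Rightarrow> bool" where
  "lie_algebra_on s L br \<longleftrightarrow> vector_space s \<and> module.subspace s L \<and>
     bilinear_product_on s L br \<and>
     (\<forall>x\<in>L. br x x = 0) \<and>
     (\<forall>x\<in>L. \<forall>y\<in>L. \<forall>z\<in>L. br x (br y z) + br y (br z x) + br z (br x y) = 0)"

definition post_lie_algebra_on ::
    "('k::field \<Rightarrow> 'a::ab_group_add \<Rightarrow> 'a) \<Rightarrow> 'a set \<Rightarrow> ('a \<Rightarrow> 'a \<Rightarrow> 'a) \<Rightarrow>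
     ('a \<Rightarrow> 'a \<Rightarrow> 'a) \<Rightarrow> bool" where
  "post_lie_algebra_on s L br st \<longleftrightarrow> lie_algebra_on s L br \<and> bilinear_product_on s L st \<and>
     (\<forall>x\<in>L. \<forall>y\<in>L. \<forall>z\<in>L.
        st x (br y z) = st (st x y) z - st x (st y z) - st (st x z) y + st x (st z y) \<and>
        st (br x y) z = br (st x z) y + br x (st y z))"

definition second_bracket ::
    "('a::ab_group_add \<Rightarrow> 'a \<Rightarrow> 'a) \<Rightarrow> ('a \<Rightarrow> 'a \<Rightarrow> 'a) \<Rightarrow> 'a \<Rightarrow> 'a \<Rightarrow> 'a" where
  "second_bracket br st x y = br x y + st x y - st y x"

definition lie_isomorphism_on ::
    "('k::field \<Rightarrow> 'a::ab_group_add \<Rightarrow> 'a) \<Rightarrow> 'a set \<Rightarrow> ('a \<Rightarrow> 'a \<Rightarrow> 'a) \<Rightarrow>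
     ('k \<Rightarrow> 'b::ab_group_add \<Rightarrow> 'b) \<Rightarrow> 'b set \<Rightarrow> ('b \<Rightarrow> 'b \<Rightarrow> 'b) \<Rightarrow> ('a \<Rightarrow> 'b) \<Rightarrow> bool" where
  "lie_isomorphism_on s L br s' L' br' \<psi> \<longleftrightarrow>
     lie_algebra_on s L br \<and> lie_algebra_on s' L' br' \<and> bij_betw \<psi> L L' \<and>
     (\<forall>x\<in>L. \<forall>y\<in>L. \<psi> (x + y) = \<psi> x + \<psi> y) \<and> (\<forall>c. \<forall>x\<in>L. \<psi> (s c x) = s' c (\<psi> x)) \<and>
     (\<forall>x\<in>L. \<forall>y\<in>L. \<psi> (br x y) = br' (\<psi> x) (\<psi> y))"

end

theory Submission
  imports Defs
begin

text \<open>Write \<open>f \<circledast> g\<close> for \<open>circ_product\<close>. For \<open>y\<close> in \<open>V\<close> one has \<open>f \<circledast> y = f y + f * y\<close>, where \<open>f \<mapsto> f * y\<close> is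
  a derivation and a coderivation. Two consequences are \<open>f * (g \<circledast> y) = (f * g) * y\<close> and
  \<open>f \<circledast> (g \<circledast> y) = (f \<circledast> g) \<circledast> y\<close>. Since \<open>f * y\<close> does not increase word length, \<open>V\<close> generates
  \<open>T(V)\<close> for \<open>\<circledast>\<close> as well, and induction along \<open>g \<mapsto> g \<circledast> y\<close> yields associativity,
  multiplicativity of the coproduct and the identity \<open>f * (g \<circledast> h) = (f * g) * h\<close>, without
  using cocommutativity. For the same reason \<open>\<phi> - id\<close> strictly lowers the length filtration, so \<open>\<phi>\<close>
  is bijective on \<open>T(V)\<close> and on every subspace that it maps to itself; \<open>Lie(V)\<close> is such a
  subspace, because on it the second bracket is the commutator of \<open>\<circledast>\<close>.\<close>

subsection \<open>Tensors and multilinear functionals\<close>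

lemma vector_space_times: "vector_space ((*) :: 'k::field \<Rightarrow> 'k \<Rightarrow> 'k)"
  by unfold_locales (simp_all add: algebra_simps)

lemma lin_ext_superset:
  assumes "vector_space s" "finite A" "Poly_Mapping.keys p \<subseteq> A"
  shows "lin_ext s f p = (\<Sum>x\<in>A. s (Poly_Mapping.lookup p x) (f x))"
proof -
  interpret vector_space s by fact
  show ?thesis
    unfolding lin_ext_def using assms(2,3)
    by (intro sum.mono_neutral_left) (auto simp: in_keys_iff)
qed

lemma linear_lin_ext:
  assumes "vector_space s"
  shows "Vector_Spaces.linear fscale s (lin_ext s f)"
proof -
  interpret vector_space s by fact
  have add: "lin_ext s f (p + q) = lin_ext s f p + lin_ext s f q" for p q
  proof -
    let ?A = "Poly_Mapping.keys p \<union> Poly_Mapping.keys q"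
    have "Poly_Mapping.keys (p + q) \<subseteq> ?A" by (rule Poly_Mapping.keys_add)
    then show ?thesis
      by (simp add: lin_ext_superset[OF assms, of ?A] Poly_Mapping.lookup_add
          scale_left_distrib sum.distrib)
  qed
  have scale: "lin_ext s f (fscale c p) = s c (lin_ext s f p)" for c p
  proof -
    have "Poly_Mapping.keys (fscale c p) \<subseteq> Poly_Mapping.keys p"
      by (auto simp: in_keys_iff lookup_fscale)
    then show ?thesis
      by (simp add: lin_ext_superset[OF assms, of "Poly_Mapping.keys p"] lookup_fscale
          scale_sum_right)
  qed
  show ?thesis
    by (simp add: Vector_Spaces.linear_iff vector_space_fscale assms add scale)
qed

lemma lin_ext_single:
  assumes "vector_space s"
  shows "lin_ext s f (Poly_Mapping.single x c) = s c (f x)"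
proof -
  interpret vector_space s by fact
  show ?thesis by (simp add: lin_ext_superset[OF assms, of "{x}"])
qed

lemma linear_lin_ext_comp:
  assumes "Vector_Spaces.linear s s' L"
  shows "L (lin_ext s f p) = lin_ext s' (\<lambda>x. L (f x)) p"
proof -
  interpret Vector_Spaces.linear s s' L by fact
  show ?thesis by (simp add: lin_ext_def sum scale)
qed

lemma lin_ext_add_fun:
  assumes "vector_space s"
  shows "lin_ext s (\<lambda>x. f x + g x) p = lin_ext s f p + lin_ext s g p"
proof -
  interpret vector_space s by fact
  show ?thesis by (simp add: lin_ext_def scale_right_distrib sum.distrib)
qed

lemma lin_ext_cong:
  "(\<And>x. x \<in> Poly_Mapping.keys p \<Longrightarrow> f x = g x) \<Longrightarrow> lin_ext s f p = lin_ext s g p"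
  by (simp add: lin_ext_def)

lemma poly_mapping_lin_ext_single:
  "lin_ext fscale (\<lambda>x. Poly_Mapping.single x 1) p = p"
proof (rule poly_mapping_eqI)
  fix y
  have "Poly_Mapping.lookup (\<Sum>x\<in>A. h x) y = (\<Sum>x\<in>A. Poly_Mapping.lookup (h x) y)"
    if "finite A" for A and h :: "'a \<Rightarrow> 'a \<Rightarrow>\<^sub>0 'b"
    using that by induction (simp_all add: Poly_Mapping.lookup_add)
  then have "Poly_Mapping.lookup (lin_ext fscale (\<lambda>x. Poly_Mapping.single x 1) p) y
      = (\<Sum>x\<in>Poly_Mapping.keys p. if x = y then Poly_Mapping.lookup p x else 0)"
    by (simp add: lin_ext_def lookup_fscale Poly_Mapping.lookup_single when_def if_distrib
        cong: if_cong)
  also have "\<dots> = Poly_Mapping.lookup p y"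
    by (simp add: in_keys_iff)
  finally show "Poly_Mapping.lookup (lin_ext fscale (\<lambda>x. Poly_Mapping.single x 1) p) y
      = Poly_Mapping.lookup p y" .
qed

text \<open>Fixing a prefix \<open>u\<close> and a suffix \<open>w\<close> expresses linearity in
  each letter for words of all lengths at once. These are the functions on words that descend to the
  tensor powers.\<close>

definition multilinear ::
    "('k::field \<Rightarrow> 'v::ab_group_add \<Rightarrow> 'v) \<Rightarrow> ('k \<Rightarrow> 'b::ab_group_add \<Rightarrow> 'b) \<Rightarrow>
     ('v list \<Rightarrow> 'b) \<Rightarrow> bool" where
  "multilinear s s' G \<longleftrightarrow> (\<forall>u w. Vector_Spaces.linear s s' (\<lambda>x. G (u @ x # w)))"

lemma multilinearD:
  assumes "multilinear s s' G"
  shows "G (u @ (x + y) # w) = G (u @ x # w) + G (u @ y # w)"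
    and "G (u @ s c x # w) = s' c (G (u @ x # w))"
    and "vector_space s" "vector_space s'"
  using assms by (auto simp: multilinear_def Vector_Spaces.linear_iff)

text \<open>The kernel of the linear extension is a subspace containing the generating relations,
  hence their span.\<close>

lemma lin_ext_tensor_eq:
  assumes G: "multilinear s s' G" and eq: "tensor_eq s p q"
  shows "lin_ext s' G p = lin_ext s' G q"
proof -
  note vs = multilinearD(4)[OF G]
  interpret L: Vector_Spaces.linear fscale s' "lin_ext s' G"
    by (rule linear_lin_ext[OF vs])
  have "multilinear_relations s \<subseteq> {r. lin_ext s' G r = 0}"
    unfolding multilinear_relations_def
  proof (rule L.vs1.span_minimal)
    show "L.vs1.subspace {r. lin_ext s' G r = 0}"
      by (rule L.subspace_kernel)
  qed (auto simp: L.diff lin_ext_single[OF vs] multilinearD(1,2)[OF G])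
  then show ?thesis
    using eq by (auto simp: tensor_eq_def L.diff)
qed

text \<open>A vector outside a subspace is separated from it by a linear functional. Equality of
  tensors can thus be tested on scalar-valued multilinear maps, which turns it into identities
  between Sweedler sums.\<close>

lemma tensor_eqI:
  fixes s :: "'k::field \<Rightarrow> 'v::ab_group_add \<Rightarrow> 'v"
  assumes vs: "vector_space s"
    and eq: "\<And>l. Vector_Spaces.linear fscale (*) l \<Longrightarrow>
      multilinear s (*) (\<lambda>w. l (Poly_Mapping.single w 1)) \<Longrightarrow> l p = l q"
  shows "tensor_eq s p q"
proof (rule ccontr)
  assume "\<not> tensor_eq s p q"
  then have notin: "p - q \<notin> multilinear_relations s" by (simp add: tensor_eq_def)
  interpret F: vector_space "fscale :: 'k \<Rightarrow> ('v list \<Rightarrow>\<^sub>0 'k) \<Rightarrow> _"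
    by (rule vector_space_fscale)
  interpret FK: vector_space_pair "fscale :: 'k \<Rightarrow> ('v list \<Rightarrow>\<^sub>0 'k) \<Rightarrow> _" "(*) :: 'k \<Rightarrow> 'k \<Rightarrow> 'k"
    by (simp add: vector_space_pair_def vector_space_fscale vector_space_times)
  have sub: "F.subspace (multilinear_relations s)"
    unfolding multilinear_relations_def by (rule F.subspace_span)
  obtain B where B: "B \<subseteq> multilinear_relations s" "F.independent B"
      "F.span B = multilinear_relations s"
    by (metis F.basis_exists F.span_subspace sub)
  \<comment> \<open>Adjoining \<open>p - q\<close> to a basis of the relations keeps it independent,
    so some functional is 1 on \<open>p - q\<close> and 0 on that basis.\<close>
  have "F.independent (insert (p - q) B)"
    using B notin by (simp add: F.independent_insert)
  from FK.linear_independent_extend[OF this, of "\<lambda>r. if r = p - q then 1 else 0"]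
  obtain l where l: "Vector_Spaces.linear fscale (*) l"
    and lB: "\<And>r. r \<in> insert (p - q) B \<Longrightarrow> l r = (if r = p - q then 1 else 0)"
    by blast
  interpret l: Vector_Spaces.linear fscale "(*)" l by fact
  have "l r = 0" if "r \<in> F.span B" for r
    using that
  proof (rule l.eq_0_on_span[rotated])
    show "l b = 0" if "b \<in> B" for b using that lB[of b] B notin by auto
  qed
  then have rel: "l r = 0" if "r \<in> multilinear_relations s" for r
    using that B by simp
  \<comment> \<open>Vanishing on the two families of generating relations is exactly additivity and
    homogeneity in each letter.\<close>
  have "multilinear s (*) (\<lambda>w. l (Poly_Mapping.single w 1))"
    unfolding multilinear_def Vector_Spaces.linear_iff
  proof (intro allI conjI)
    fix u w x y c
    have "l (Poly_Mapping.single (u @ (x + y) # w) 1 - Poly_Mapping.single (u @ x # w) 1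
         - Poly_Mapping.single (u @ y # w) 1) = 0"
      by (rule rel) (unfold multilinear_relations_def, rule F.span_base, blast)
    then show "l (Poly_Mapping.single (u @ (x + y) # w) 1) =
       l (Poly_Mapping.single (u @ x # w) 1) + l (Poly_Mapping.single (u @ y # w) 1)"
      by (simp only: l.diff l.add diff_diff_eq right_minus_eq)
    have "l (Poly_Mapping.single (u @ s c x # w) 1 - Poly_Mapping.single (u @ x # w) c) = 0"
      by (rule rel) (unfold multilinear_relations_def, rule F.span_base, blast)
    moreover have "Poly_Mapping.single (u @ x # w) c
        = fscale c (Poly_Mapping.single (u @ x # w) 1)"
      by (rule poly_mapping_eqI) (simp add: lookup_fscale Poly_Mapping.lookup_single when_def)
    ultimately show "l (Poly_Mapping.single (u @ s c x # w) 1)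
        = c * l (Poly_Mapping.single (u @ x # w) 1)"
      by (simp add: l.diff l.scale)
  qed (rule vs vector_space_times)+
  from eq[OF l this] lB[of "p - q"] show False by (simp add: l.diff)
qed

section \<open>Sweedler sums over formal tensors\<close>

lemma sweedler_linear:
  assumes "Vector_Spaces.linear s s' L"
  shows "L (sweedler s F p) = sweedler s' (\<lambda>a b. L (F a b)) p"
  unfolding sweedler_def by (rule linear_lin_ext_comp[OF assms])

lemma sweedler_add_fun:
  assumes "vector_space s"
  shows "sweedler s (\<lambda>a b. F a b + G a b) p = sweedler s F p + sweedler s G p"
  unfolding sweedler_def by (rule lin_ext_add_fun[OF assms])

lemma sweedler_scale_fun:
  assumes "vector_space s"
  shows "sweedler s (\<lambda>a b. s c (F a b)) p = s c (sweedler s F p)"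
proof -
  interpret vector_space s by fact
  have "Vector_Spaces.linear s s (s c)" by (rule linear_scale_self)
  from sweedler_linear[OF this] show ?thesis by (rule sym)
qed

lemma sweedler_zero_fun:
  assumes "vector_space s"
  shows "sweedler s (\<lambda>a b. 0) p = 0"
proof -
  interpret vector_space s by fact
  show ?thesis by (simp add: sweedler_def lin_ext_def)
qed

text \<open>Multilinearity is demanded at every word length; reading off \<open>w ! 0\<close> and
  \<open>w ! 1\<close> alone would in general violate it on longer words. The value 0 off length 2
  repairs this.\<close>

definition pairing :: "('a \<Rightarrow> 'a \<Rightarrow> 'b::zero) \<Rightarrow> 'a list \<Rightarrow> 'b" where
  "pairing F w = (if length w = 2 then F (w ! 0) (w ! 1) else 0)"

lemma multilinear_pairing:
  assumes "bilinear_map s s s' F"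
  shows "multilinear s s' (pairing F)"
proof -
  have F: "vector_space s" "vector_space s'"
    "F (x + y) z = F x z + F y z" "F z (x + y) = F z x + F z y"
    "F (s c x) z = s' c (F x z)" "F z (s c x) = s' c (F z x)" for x y z c
    using assms by (auto simp: bilinear_map_def Vector_Spaces.linear_iff)
  interpret V': vector_space s' by (rule F)
  \<comment> \<open>In a word of length 2 the marked letter \<open>x\<close> is either the second or
    the first; at all other lengths both sides of the linearity conditions vanish.\<close>
  have len: "length (u @ x # w) = 2 \<longleftrightarrow> (\<exists>a. u = [a] \<and> w = []) \<or> (\<exists>b. u = [] \<and> w = [b])"
    for u w :: "'b list" and x
    by (cases u; cases w) auto
  show ?thesis
    unfolding multilinear_def Vector_Spaces.linear_iff pairing_def
    by (auto simp del: length_append simp: len F)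
qed

lemma sweedler_eq_pairing:
  assumes "\<And>w. w \<in> Poly_Mapping.keys p \<Longrightarrow> length w = 2"
  shows "sweedler s F p = lin_ext s (pairing F) p"
  unfolding sweedler_def by (rule lin_ext_cong) (simp add: pairing_def assms)


subsection \<open>Sweedler sums on the tensor algebra\<close>

locale post_lie_tensor = tensor_algebra sV sT \<iota>
  for sV :: "'k::field \<Rightarrow> 'v::ab_group_add \<Rightarrow> 'v"
    and sT :: "'k \<Rightarrow> 'a::ring_1 \<Rightarrow> 'a"
    and \<iota> :: "'v \<Rightarrow> 'a" +
  fixes \<Delta> :: "'a \<Rightarrow> ('a list \<Rightarrow>\<^sub>0 'k)"
    and \<epsilon> :: "'a \<Rightarrow> 'k"
    and starV :: "'v \<Rightarrow> 'v \<Rightarrow> 'v"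
    and star :: "'a \<Rightarrow> 'a \<Rightarrow> 'a"
  assumes coproduct: "deshuffling_coproduct sT \<iota> \<Delta>"
    and counit: "deshuffling_counit sT \<iota> \<epsilon>"
    and starV_bilinear: "bilinear_map sV sV sV starV"
    and star_ext: "star_extension sT \<iota> \<Delta> \<epsilon> starV star"
begin

abbreviation bil :: "('k \<Rightarrow> 'b::ab_group_add \<Rightarrow> 'b) \<Rightarrow> ('a \<Rightarrow> 'a \<Rightarrow> 'b) \<Rightarrow> bool" where
  "bil s F \<equiv> bilinear_map sT sT s F"

abbreviation Sw :: "('k \<Rightarrow> 'b::ab_group_add \<Rightarrow> 'b) \<Rightarrow> ('a \<Rightarrow> 'a \<Rightarrow> 'b) \<Rightarrow> 'a \<Rightarrow> 'b" where
  "Sw s F h \<equiv> sweedler s F (\<Delta> h)"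

abbreviation word :: "'v list \<Rightarrow> 'a" where
  "word xs \<equiv> prod_list (map \<iota> xs)"

abbreviation circ :: "'a \<Rightarrow> 'a \<Rightarrow> 'a" where
  "circ \<equiv> circ_product sT \<Delta> star"

lemma bil_iff:
  "bil s F \<longleftrightarrow> vector_space s \<and>
     (\<forall>x y z. F (x + y) z = F x z + F y z) \<and> (\<forall>x y z. F x (y + z) = F x y + F x z) \<and>
     (\<forall>c x y. F (sT c x) y = s c (F x y)) \<and> (\<forall>c x y. F x (sT c y) = s c (F x y))"
  using T.vector_space_axioms unfolding bilinear_map_def Vector_Spaces.linear_iff by blast

lemma bilD:
  assumes "bil s F"
  shows "vector_space s" "F (x + y) z = F x z + F y z" "F x (y + z) = F x y + F x z"
    "F (sT c x) y = s c (F x y)" "F x (sT c y) = s c (F x y)" "F 0 x = 0" "F x 0 = 0"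
proof -
  show *: "vector_space s" "F (x + y) z = F x z + F y z" "F x (y + z) = F x y + F x z"
    "F (sT c x) y = s c (F x y)" "F x (sT c y) = s c (F x y)" for x y z c
    using assms unfolding bil_iff by blast+
  show "F 0 x = 0" "F x 0 = 0"
    using *(2)[of 0 0 x] *(3)[of x 0 0] by simp_all
qed

lemma bilI:
  assumes "vector_space s" "\<And>x y z. F (x + y) z = F x z + F y z"
    "\<And>x y z. F x (y + z) = F x y + F x z"
    "\<And>c x y. F (sT c x) y = s c (F x y)" "\<And>c x y. F x (sT c y) = s c (F x y)"
  shows "bil s F"
  using assms unfolding bil_iff by blast

lemma mult_scale: "sT c f * g = sT c (f * g)" "f * sT c g = sT c (f * g)"
  using bilD(4,5)[OF times_bilinear] by auto

lemma bil_star: "bil sT star"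
  using star_ext by (simp add: star_extension_def)

lemma star_simps:
  "star (f + g) h = star f h + star g h" "star f (g + h) = star f g + star f h"
  "star (sT c f) h = sT c (star f h)" "star f (sT c h) = sT c (star f h)"
  "star 0 h = 0" "star h 0 = 0"
  using bilD[OF bil_star] by auto

lemma star_iota: "star (\<iota> x) (\<iota> y) = \<iota> (starV x y)"
  and star_one_right: "star f 1 = f"
  and star_one_left: "star 1 f = sT (\<epsilon> f) 1"
  and star_iota_times_iota:
    "star (\<iota> x) (f * \<iota> y) = star (star (\<iota> x) f) (\<iota> y) - star (\<iota> x) (star f (\<iota> y))"
  and star_times: "star (f * g) h = Sw sT (\<lambda>a b. star f a * star g b) h"
  using star_ext unfolding star_extension_def by blast+

section \<open>Induction over words and the universal property of the tensor algebra\<close>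

lemma word_induct [case_names add scale word]:
  assumes add: "\<And>f g. P f \<Longrightarrow> P g \<Longrightarrow> P (f + g)"
    and scale: "\<And>c f. P f \<Longrightarrow> P (sT c f)"
    and word: "\<And>xs. P (word xs)"
  shows "P h"
proof -
  obtain p where h: "h = lin_ext sT word p"
    using words_surj by (metis surjD)
  have "P (\<Sum>x\<in>A. sT (c x) (word x))" if "finite A" for A and c :: "'v list \<Rightarrow> 'k"
    using that
  proof induction
    case empty
    \<comment> \<open>The empty sum is 0 times a word, so \<open>P 0\<close> need not be a separate
      premise.\<close>
    then show ?case using scale[OF word, of 0] by simp
  next
    case (insert x A)
    then show ?case by (simp add: add scale word)
  qed
  then show ?thesis by (simp add: h lin_ext_def)
qed

lemma left_induct [case_names add scale one iota]:
  assumes "\<And>f g. P f \<Longrightarrow> P g \<Longrightarrow> P (f + g)" "\<And>c f. P f \<Longrightarrow> P (sT c f)"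
    and one: "P 1" and iota: "\<And>x f. P f \<Longrightarrow> P (\<iota> x * f)"
  shows "P h"
proof (induction h rule: word_induct)
  case (word xs)
  show ?case by (induction xs) (simp_all add: one iota)
qed (use assms in auto)

lemma right_induct [case_names add scale one iota]:
  assumes "\<And>f g. P f \<Longrightarrow> P g \<Longrightarrow> P (f + g)" "\<And>c f. P f \<Longrightarrow> P (sT c f)"
    and one: "P 1" and iota: "\<And>f y. P f \<Longrightarrow> P (f * \<iota> y)"
  shows "P h"
proof (induction h rule: word_induct)
  case (word xs)
  show ?case by (induction xs rule: rev_induct) (simp_all add: one iota)
qed (use assms in auto)

lemma lin_ext_word_single: "lin_ext sT word (Poly_Mapping.single xs c) = sT c (word xs)"
  by (rule lin_ext_single[OF T.vector_space_axioms])

text \<open>The relations for one-letter words, read through \<open>words_eq_iff\<close>, force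
  linearity of \<open>\<iota>\<close>.\<close>

lemma linear_iota: "\<iota> (x + y) = \<iota> x + \<iota> y" "\<iota> (sV c x) = sT c (\<iota> x)"
proof -
  interpret F: vector_space "fscale :: 'k \<Rightarrow> ('v list \<Rightarrow>\<^sub>0 'k) \<Rightarrow> _"
    by (rule vector_space_fscale)
  interpret L: Vector_Spaces.linear fscale sT "lin_ext sT word"
    by (rule linear_lin_ext[OF T.vector_space_axioms])
  \<comment> \<open>The one-letter word is spelled \<open>[] @ x # []\<close> to match the
    generating relations literally.\<close>
  let ?s = "\<lambda>x c. Poly_Mapping.single ([] @ x # []) (c::'k) :: 'v list \<Rightarrow>\<^sub>0 'k"
  have "?s (x + y) 1 - ?s x 1 - ?s y 1 \<in> multilinear_relations sV"
    unfolding multilinear_relations_def by (rule F.span_base) blast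
  then have "lin_ext sT word (?s (x + y) 1 - ?s x 1) = lin_ext sT word (?s y 1)"
    unfolding words_eq_iff tensor_eq_def .
  then show "\<iota> (x + y) = \<iota> x + \<iota> y"
    by (simp add: L.diff lin_ext_word_single algebra_simps)
  have "?s (sV c x) 1 - ?s x c \<in> multilinear_relations sV"
    unfolding multilinear_relations_def by (rule F.span_base) blast
  then have "lin_ext sT word (?s (sV c x) 1) = lin_ext sT word (?s x c)"
    unfolding words_eq_iff tensor_eq_def .
  then show "\<iota> (sV c x) = sT c (\<iota> x)"
    by (simp add: lin_ext_word_single)
qed

text \<open>This is the universal property of the tensor algebra for linear maps: they may be
  prescribed on words by any multilinear function.\<close>

lemma word_lift:
  assumes G: "multilinear sV s G"
  obtains \<phi> where "Vector_Spaces.linear sT s \<phi>" "\<And>xs. \<phi> (word xs) = G xs"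
proof -
  note vs = multilinearD(4)[OF G]
  interpret L: Vector_Spaces.linear fscale sT "lin_ext sT word"
    by (rule linear_lin_ext[OF T.vector_space_axioms])
  interpret M: Vector_Spaces.linear fscale s "lin_ext s G"
    by (rule linear_lin_ext[OF vs])
  \<comment> \<open>Any preimage under evaluation of words serves: two preimages are related by
    \<open>tensor_eq\<close>, and \<open>lin_ext s G\<close> does not distinguish them.\<close>
  define \<phi> where "\<phi> h = lin_ext s G (inv (lin_ext sT word) h)" for h
  have \<phi>: "\<phi> (lin_ext sT word p) = lin_ext s G p" for p
    unfolding \<phi>_def
    by (rule lin_ext_tensor_eq[OF G], subst words_eq_iff[symmetric])
       (rule surj_f_inv_f[OF words_surj])
  have repr: "\<exists>p. f = lin_ext sT word p" for f
    using words_surj by (metis surjD)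
  have "\<phi> (f + g) = \<phi> f + \<phi> g" for f g
    using repr[of f] repr[of g] by (auto simp: \<phi> M.add simp flip: L.add)
  moreover have "\<phi> (sT c f) = s c (\<phi> f)" for c f
    using repr[of f] by (auto simp: \<phi> M.scale simp flip: L.scale)
  ultimately have "Vector_Spaces.linear sT s \<phi>"
    unfolding Vector_Spaces.linear_iff using vs T.vector_space_axioms by blast
  moreover have "\<phi> (word xs) = G xs" for xs
    using \<phi>[of "Poly_Mapping.single xs 1"] vector_space.vector_space_assms(4)[OF vs]
    by (simp add: lin_ext_word_single lin_ext_single[OF vs])
  ultimately show ?thesis using that by blast
qed

section \<open>Evaluating bilinear maps on the coproduct\<close>

lemma linear_into: "linear_into_tens2 sT \<Delta>"
  using coproduct by (simp add: deshuffling_coproduct_def)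

lemma Sw_eq_pairing: "Sw s F h = lin_ext s (pairing F) (\<Delta> h)"
  using linear_into by (intro sweedler_eq_pairing) (auto simp: linear_into_tens2_def)

lemma lin_ext_pairing_tens2:
  assumes "vector_space s"
  shows "lin_ext s (pairing F) (tens2 a b) = F a b"
  using vector_space.vector_space_assms(4)[OF assms]
  by (simp add: lin_ext_single[OF assms] pairing_def)

lemma lin_ext_pairing_sweedler:
  assumes "vector_space s"
  shows "lin_ext s H (sweedler fscale G p) = sweedler s (\<lambda>a b. lin_ext s H (G a b)) p"
  by (rule sweedler_linear[OF linear_lin_ext[OF assms]])

text \<open>A bilinear \<open>F\<close> sees only the tensor class of \<open>\<Delta> h\<close>, so
  the chosen representative may be exchanged. This is the only route by which the axioms of
  \<open>\<Delta>\<close>, which hold up to \<open>tensor_eq\<close>, become equations.\<close>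

lemma Sw_tensor_eq:
  assumes "bil s F" "tensor_eq sT (\<Delta> h) q"
  shows "Sw s F h = lin_ext s (pairing F) q"
  unfolding Sw_eq_pairing using assms by (intro lin_ext_tensor_eq multilinear_pairing)

lemma Sw_add: "bil s F \<Longrightarrow> Sw s F (f + g) = Sw s F f + Sw s F g"
  and Sw_scale: "bil s F \<Longrightarrow> Sw s F (sT c f) = s c (Sw s F f)"
proof -
  assume F: "bil s F"
  interpret L: Vector_Spaces.linear fscale s "lin_ext s (pairing F)"
    by (rule linear_lin_ext[OF bilD(1)[OF F]])
  have "tensor_eq sT (\<Delta> (f + g)) (\<Delta> f + \<Delta> g)" "tensor_eq sT (\<Delta> (sT c f)) (fscale c (\<Delta> f))"
    using linear_into by (auto simp: linear_into_tens2_def)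
  from this[THEN Sw_tensor_eq[OF F]]
  show "Sw s F (f + g) = Sw s F f + Sw s F g" "Sw s F (sT c f) = s c (Sw s F f)"
    by (simp_all add: L.add L.scale Sw_eq_pairing)
qed

lemma Sw_zero: "bil s F \<Longrightarrow> Sw s F 0 = 0"
  using Sw_add[of s F 0 0] by simp

lemma Sw_one:
  assumes "bil s F"
  shows "Sw s F 1 = F 1 1"
proof -
  have "tensor_eq sT (\<Delta> 1) (tens2 1 1)"
    using coproduct by (simp add: deshuffling_coproduct_def)
  from Sw_tensor_eq[OF assms this] show ?thesis
    by (simp add: lin_ext_pairing_tens2 bilD(1)[OF assms])
qed

lemma Sw_iota:
  assumes "bil s F"
  shows "Sw s F (\<iota> x) = F (\<iota> x) 1 + F 1 (\<iota> x)"
proof -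
  note vs = bilD(1)[OF assms]
  interpret L: Vector_Spaces.linear fscale s "lin_ext s (pairing F)"
    by (rule linear_lin_ext[OF vs])
  have "tensor_eq sT (\<Delta> (\<iota> x)) (tens2 (\<iota> x) 1 + tens2 1 (\<iota> x))"
    using coproduct by (simp add: deshuffling_coproduct_def)
  from Sw_tensor_eq[OF assms this] show ?thesis
    by (simp add: lin_ext_pairing_tens2 vs L.add)
qed

lemma lin_ext_pairing_tens_mult:
  assumes "vector_space s"
  shows "lin_ext s (pairing F) (tens_mult m p q)
    = sweedler s (\<lambda>a b. sweedler s (\<lambda>c d. F (m a c) (m b d)) q) p"
  unfolding tens_mult_def
  by (simp add: lin_ext_pairing_sweedler[OF assms] lin_ext_pairing_tens2[OF assms])

lemma Sw_times:
  assumes "bil s F"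
  shows "Sw s F (f * g) = Sw s (\<lambda>a b. Sw s (\<lambda>c d. F (a * c) (b * d)) g) f"
proof -
  have "tensor_eq sT (\<Delta> (f * g)) (tens_mult (*) (\<Delta> f) (\<Delta> g))"
    using coproduct by (simp add: deshuffling_coproduct_def)
  from Sw_tensor_eq[OF assms this] show ?thesis
    by (simp add: lin_ext_pairing_tens_mult bilD(1)[OF assms])
qed

lemma bil_times:
  assumes "bil s F"
  shows "bil s (\<lambda>c d. F (a * c) (b * d))"
  using bilD[OF assms] by (intro bilI) (auto simp: distrib_left mult_scale)

lemma Sw_times_iota:
  assumes "bil s F"
  shows "Sw s F (f * \<iota> y) = Sw s (\<lambda>a b. F (a * \<iota> y) b + F a (b * \<iota> y)) f"
  by (simp add: Sw_times[OF assms] Sw_iota[OF bil_times[OF assms]])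

lemma Sw_iota_times:
  assumes "bil s F"
  shows "Sw s F (\<iota> y * f) = Sw s (\<lambda>a b. F (\<iota> y * a) b + F a (\<iota> y * b)) f"
proof -
  \<comment> \<open>The letter now stands in the outer sum, so \<open>Sw_iota\<close> applies only
    once the inner sum over \<open>f\<close> is known to be bilinear in \<open>a\<close> and
    \<open>b\<close>.\<close>
  have "bil s (\<lambda>a b. Sw s (\<lambda>c d. F (a * c) (b * d)) f)"
    using bilD[OF assms]
    by (intro bilI)
       (simp_all add: distrib_right mult_scale sweedler_add_fun
         sweedler_scale_fun[OF bilD(1)[OF assms]])
  then show ?thesis
    by (simp add: Sw_times[OF assms] Sw_iota sweedler_add_fun bilD(1)[OF assms])
qed


section \<open>Counit laws and coassociativity\<close>

lemma counit_simps:
  "\<epsilon> (f + g) = \<epsilon> f + \<epsilon> g" "\<epsilon> (sT c f) = c * \<epsilon> f" "\<epsilon> 1 = 1"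
  "\<epsilon> 0 = 0"
  "xs \<noteq> [] \<Longrightarrow> \<epsilon> (word xs) = 0"
proof -
  interpret E: Vector_Spaces.linear sT "(*)" \<epsilon>
    using counit by (simp add: deshuffling_counit_def)
  show "\<epsilon> (f + g) = \<epsilon> f + \<epsilon> g" "\<epsilon> (sT c f) = c * \<epsilon> f" "\<epsilon> 1 = 1" "\<epsilon> 0 = 0"
    "xs \<noteq> [] \<Longrightarrow> \<epsilon> (word xs) = 0"
    using counit by (auto simp: deshuffling_counit_def E.add E.scale E.zero)
qed

lemma counit_iota_times [simp]: "\<epsilon> (\<iota> x * f) = 0"
proof (induction f rule: word_induct)
  case (word xs)
  then show ?case using counit_simps(5)[of "x # xs"] by simp
qed (simp_all add: distrib_left mult_scale counit_simps)

lemma counit_times_iota [simp]: "\<epsilon> (f * \<iota> y) = 0"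
proof (induction f rule: word_induct)
  case (word xs)
  then show ?case using counit_simps(5)[of "xs @ [y]"] by simp
qed (simp_all add: distrib_right mult_scale counit_simps)

lemma counit_iota [simp]: "\<epsilon> (\<iota> y) = 0"
  using counit_times_iota[of 1 y] by simp

lemma counit_times: "\<epsilon> (f * g) = \<epsilon> f * \<epsilon> g"
  by (induction f rule: left_induct)
     (simp_all add: distrib_right mult_scale counit_simps mult.assoc algebra_simps)

lemma linear_counit: "Vector_Spaces.linear sT (*) \<epsilon>"
  using counit by (simp add: deshuffling_counit_def)

lemma bil_counit_left: "Vector_Spaces.linear sT sT L \<Longrightarrow> bil sT (\<lambda>a b. sT (\<epsilon> a) (L b))"
  and bil_counit_right: "Vector_Spaces.linear sT sT L \<Longrightarrow> bil sT (\<lambda>a b. sT (\<epsilon> b) (L a))"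
  unfolding Vector_Spaces.linear_iff bil_iff
  by (auto simp: counit_simps T.scale_left_distrib T.scale_right_distrib mult.commute)

text \<open>A last letter \<open>y\<close> is attached to either tensor factor; attached to the left
  one it is killed by \<open>\<epsilon>\<close>, and the other term is the induction hypothesis
  times \<open>\<iota> y\<close>.\<close>

lemma Sw_counit_left: "Sw sT (\<lambda>a b. sT (\<epsilon> a) b) h = h"
proof -
  note bil = bil_counit_left[OF T.linear_id, unfolded id_def]
  show ?thesis
  proof (induction h rule: right_induct)
    case (iota f y)
    have lin: "Vector_Spaces.linear sT sT (\<lambda>f. f * \<iota> y)"
      using times_bilinear by (simp add: bilinear_map_def)
    have "Sw sT (\<lambda>a b. sT (\<epsilon> a) b) (f * \<iota> y) = Sw sT (\<lambda>a b. sT (\<epsilon> a) b * \<iota> y) f"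
      by (simp add: Sw_times_iota[OF bil] mult_scale)
    also have "\<dots> = f * \<iota> y"
      using sweedler_linear[OF lin] iota by metis
    finally show ?case .
  qed (simp_all add: Sw_add[OF bil] Sw_scale[OF bil] Sw_one[OF bil] counit_simps)
qed

lemma Sw_counit_right: "Sw sT (\<lambda>a b. sT (\<epsilon> b) a) h = h"
proof -
  note bil = bil_counit_right[OF T.linear_id, unfolded id_def]
  show ?thesis
  proof (induction h rule: right_induct)
    case (iota f y)
    have lin: "Vector_Spaces.linear sT sT (\<lambda>f. f * \<iota> y)"
      using times_bilinear by (simp add: bilinear_map_def)
    have "Sw sT (\<lambda>a b. sT (\<epsilon> b) a) (f * \<iota> y) = Sw sT (\<lambda>a b. sT (\<epsilon> b) a * \<iota> y) f"
      by (simp add: Sw_times_iota[OF bil] mult_scale)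
    also have "\<dots> = f * \<iota> y"
      using sweedler_linear[OF lin] iota by metis
    finally show ?case .
  qed (simp_all add: Sw_add[OF bil] Sw_scale[OF bil] Sw_one[OF bil] counit_simps)
qed

text \<open>The two conditions on \<open>F\<close> together say that it is trilinear. The induction
  generalizes over \<open>F\<close>, since a last letter of \<open>h\<close> can be absorbed into a
  new trilinear map.\<close>

lemma Sw_coassoc:
  assumes vs: "vector_space s"
    and F: "\<And>a. bil s (F a)" "\<And>b. bil s (\<lambda>a. F a b)"
  shows "Sw s (\<lambda>a b. Sw s (\<lambda>a1 a2. F a1 a2 b) a) h = Sw s (\<lambda>a b. Sw s (\<lambda>b1 b2. F a b1 b2) b) h"
  using F
proof (induction h arbitrary: F rule: right_induct)
  have bil: "bil s (\<lambda>a1 a2. F a1 a2 b)" "bil s (\<lambda>a b. Sw s (\<lambda>a1 a2. F a1 a2 b) a)"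
    "bil s (\<lambda>a b. Sw s (F a) b)"
    if F: "\<And>a. bil s (F a)" "\<And>b. bil s (\<lambda>a. F a b)" for F b
  proof -
    note F1 = bilD[OF F(1)] and F2 = bilD[OF F(2)]
    show *: "bil s (\<lambda>a1 a2. F a1 a2 b)" for b
      using vs by (intro bilI) (simp_all add: F1 F2)
    show "bil s (\<lambda>a b. Sw s (\<lambda>a1 a2. F a1 a2 b) a)"
      using vs by (intro bilI)
        (simp_all add: Sw_add[OF *] Sw_scale[OF *] sweedler_add_fun sweedler_scale_fun[OF vs] F1)
    have "F (x + y) = (\<lambda>a b. F x a b + F y a b)" "F (sT c x) = (\<lambda>a b. s c (F x a b))" for x y c
      by (simp_all add: fun_eq_iff F2)
    then show "bil s (\<lambda>a b. Sw s (F a) b)"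
      using vs by (intro bilI)
        (simp_all add: Sw_add[OF F(1)] Sw_scale[OF F(1)]
          sweedler_add_fun[OF vs] sweedler_scale_fun[OF vs])
  qed
  {
    case (add f g)
    note bil' = bil[OF add.prems]
    show ?case by (simp add: Sw_add[OF bil'(2)] Sw_add[OF bil'(3)] add.IH[OF add.prems])
  next
    case (scale c f)
    note bil' = bil[OF scale.prems]
    show ?case by (simp add: Sw_scale[OF bil'(2)] Sw_scale[OF bil'(3)] scale.IH[OF scale.prems])
  next
    case one
    note bil' = bil[OF one.prems]
    show ?case
      by (simp add: Sw_one[OF bil'(1)] Sw_one[OF bil'(2)] Sw_one[OF bil'(3)] Sw_one[OF one.prems(1)])
  next
    case (iota f y)
    note bil' = bil[OF iota.prems]
    \<comment> \<open>Iterating the coproduct in either order attaches \<open>y\<close> to each of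
      the three factors in turn.\<close>
    let ?G = "\<lambda>a b c. F (a * \<iota> y) b c + F a (b * \<iota> y) c + F a b (c * \<iota> y)"
    have G: "bil s (?G a)" "bil s (\<lambda>a. ?G a b)" for a b
      using vs bilD[OF iota.prems(1)] bilD[OF iota.prems(2)]
      by (intro bilI; simp add: distrib_right mult_scale
          vector_space.vector_space_assms(1)[OF vs])+
    have "Sw s (\<lambda>a b. Sw s (\<lambda>a1 a2. F a1 a2 b) a) (f * \<iota> y) =
        Sw s (\<lambda>a b. Sw s (\<lambda>a1 a2. ?G a1 a2 b) a) f"
      by (simp add: Sw_times_iota[OF bil'(2)] Sw_times_iota[OF bil'(1)] sweedler_add_fun[OF vs])
    also have "\<dots> = Sw s (\<lambda>a b. Sw s (\<lambda>b1 b2. ?G a b1 b2) b) f"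
      by (rule iota.IH[OF G])
    also have "\<dots> = Sw s (\<lambda>a b. Sw s (\<lambda>b1 b2. F a b1 b2) b) (f * \<iota> y)"
      by (simp add: Sw_times_iota[OF bil'(3)] Sw_times_iota[OF iota.prems(1)]
          sweedler_add_fun[OF vs] add.assoc)
    finally show ?case .
  }
qed

subsection \<open>The extended product and the circle product\<close>

lemma star_one_iota [simp]: "star 1 (\<iota> y) = 0"
  by (simp add: star_one_left)

lemma bil_star_times: "bil sT (\<lambda>a b. star f a * star g b)" "bil sT (\<lambda>a b. star f a * b)"
  by (rule bilI; simp add: T.vector_space_axioms star_simps distrib_left distrib_right mult_scale)+

lemma star_times_iota: "star (f * g) (\<iota> y) = star f (\<iota> y) * g + f * star g (\<iota> y)"
  by (simp add: star_times Sw_iota[OF bil_star_times(1)] star_one_right)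

lemma circ_iota: "circ f (\<iota> y) = star f (\<iota> y) + f * \<iota> y"
  by (simp add: circ_product_def Sw_iota[OF bil_star_times(2)] star_one_right)

lemma circ_one_right [simp]: "circ f 1 = f"
  by (simp add: circ_product_def Sw_one[OF bil_star_times(2)] star_one_right)

lemma circ_one_left [simp]: "circ 1 f = f"
  by (simp add: circ_product_def star_one_left mult_scale Sw_counit_left)

lemma bil_circ: "bil sT circ"
proof (rule bilI)
  fix f g h c
  have "Sw sT (\<lambda>a b. star (f + g) a * b) h = Sw sT (\<lambda>a b. star f a * b + star g a * b) h"
    by (intro arg_cong[where f = "\<lambda>F. Sw sT F h"] ext) (simp add: star_simps distrib_right)
  then show "circ (f + g) h = circ f h + circ g h"
    by (simp add: circ_product_def sweedler_add_fun[OF T.vector_space_axioms])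
  have "Sw sT (\<lambda>a b. star (sT c f) a * b) h = Sw sT (\<lambda>a b. sT c (star f a * b)) h"
    by (intro arg_cong[where f = "\<lambda>F. Sw sT F h"] ext) (simp add: star_simps mult_scale)
  then show "circ (sT c f) h = sT c (circ f h)"
    by (simp add: circ_product_def sweedler_scale_fun[OF T.vector_space_axioms])
qed (simp_all add: circ_product_def T.vector_space_axioms Sw_add[OF bil_star_times(2)]
    Sw_scale[OF bil_star_times(2)])

lemma circ_simps:
  "circ (f + g) h = circ f h + circ g h" "circ f (g + h) = circ f g + circ f h"
  "circ (sT c f) h = sT c (circ f h)" "circ f (sT c h) = sT c (circ f h)"
  "circ 0 h = 0" "circ h 0 = 0"
  using bilD[OF bil_circ] by auto

text \<open>The correction term in the rule for \<open>star (\<iota> x) (f * \<iota> y)\<close> is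
  exactly what \<open>circ\<close> adds. This is the one-letter case of
  \<open>star_circ_iota\<close>.\<close>

lemma star_iota_circ_iota: "star (\<iota> x) (circ f (\<iota> y)) = star (star (\<iota> x) f) (\<iota> y)"
  by (simp add: circ_iota star_simps star_iota_times_iota)

text \<open>This is the coderivation property. On \<open>g * \<iota> z\<close> the derivation rule
  gives a term with \<open>star g (\<iota> y)\<close>, covered by the induction hypothesis for a
  modified \<open>F\<close>, and one where \<open>z\<close> is replaced by \<open>starV z y\<close>,
  again a primitive letter.\<close>

lemma Sw_star_iota:
  assumes "bil s F"
  shows "Sw s F (star f (\<iota> y)) = Sw s (\<lambda>a b. F (star a (\<iota> y)) b + F a (star b (\<iota> y))) f"
  using assms
proof (induction f arbitrary: F rule: right_induct)
  have bil: "bil s (\<lambda>a b. F (star a (\<iota> y)) b + F a (star b (\<iota> y)))"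
    and bil_z: "bil s (\<lambda>a b. F (a * \<iota> z) b + F a (b * \<iota> z))"
    if F: "bil s F" for F z
    using bilD[OF F]
    by (intro bilI; simp add: star_simps distrib_right mult_scale
        vector_space.vector_space_assms(1)[OF bilD(1)[OF F]])+
  {
    case (add f g)
    then show ?case by (simp add: star_simps Sw_add[OF add.prems] Sw_add[OF bil])
  next
    case (scale c f)
    then show ?case by (simp add: star_simps Sw_scale[OF scale.prems] Sw_scale[OF bil])
  next
    case one
    then show ?case by (simp add: Sw_zero Sw_one[OF bil] bilD(6,7))
  next
    case (iota g z)
    note F = iota.prems and vs = bilD(1)[OF iota.prems]
    have "Sw s F (star (g * \<iota> z) (\<iota> y)) =
        Sw s (\<lambda>a b. F (a * \<iota> z) b + F a (b * \<iota> z)) (star g (\<iota> y)) +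
        Sw s (\<lambda>a b. F (a * \<iota> (starV z y)) b + F a (b * \<iota> (starV z y))) g"
      by (simp only: star_times_iota star_iota Sw_add[OF F] Sw_times_iota[OF F])
    also have "\<dots> = Sw s (\<lambda>a b. (F (star a (\<iota> y) * \<iota> z) b + F (star a (\<iota> y)) (b * \<iota> z)) +
        (F (a * \<iota> z) (star b (\<iota> y)) + F a (star b (\<iota> y) * \<iota> z)) +
        (F (a * \<iota> (starV z y)) b + F a (b * \<iota> (starV z y)))) g"
      unfolding iota.IH[OF bil_z[OF F]] by (simp only: sweedler_add_fun[OF vs])
    also have "\<dots> = Sw s (\<lambda>a b. F (star a (\<iota> y)) b + F a (star b (\<iota> y))) (g * \<iota> z)"
      unfolding Sw_times_iota[OF bil[OF F]]
      by (simp add: star_times_iota star_iota bilD(2,3)[OF F] ac_simps)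
    finally show ?case .
  }
qed

lemma Sw_circ_iota:
  assumes "bil s F"
  shows "Sw s F (circ f (\<iota> y)) = Sw s (\<lambda>a b. F (circ a (\<iota> y)) b + F a (circ b (\<iota> y))) f"
  by (simp add: circ_iota Sw_add[OF assms] Sw_star_iota[OF assms] Sw_times_iota[OF assms]
      bilD(2,3)[OF assms] sweedler_add_fun[OF bilD(1)[OF assms]])

lemma counit_star_iota [simp]: "\<epsilon> (star f (\<iota> y)) = 0"
  by (induction f rule: left_induct)
     (simp_all add: star_simps counit_simps star_times_iota star_iota)

lemma counit_circ_iota [simp]: "\<epsilon> (circ f (\<iota> y)) = 0"
  by (simp add: circ_iota counit_simps)

lemma linear_star_left: "Vector_Spaces.linear sT sT (\<lambda>f. star f g)"
  using bil_star by (simp add: bilinear_map_def)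

text \<open>For a product \<open>\<iota> x * f\<close> the coderivation rule distributes
  \<open>circ\<close> by \<open>\<iota> y\<close> over the two Sweedler factors of \<open>g\<close>;
  the letter case and the induction hypothesis act on one factor each, and the derivation rule
  reassembles the result.\<close>

lemma star_circ_iota: "star f (circ g (\<iota> y)) = star (star f g) (\<iota> y)"
proof (induction f arbitrary: g rule: left_induct)
  case (iota x f)
  have "star (\<iota> x * f) (circ g (\<iota> y)) =
      Sw sT (\<lambda>a b. star (\<iota> x) (circ a (\<iota> y)) * star f b
        + star (\<iota> x) a * star f (circ b (\<iota> y))) g"
    by (simp add: star_times Sw_circ_iota[OF bil_star_times(1)])
  also have "\<dots> = Sw sT (\<lambda>a b. star (star (\<iota> x) a * star f b) (\<iota> y)) g"
    by (simp add: star_iota_circ_iota iota.IH star_times_iota)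
  also have "\<dots> = star (star (\<iota> x * f) g) (\<iota> y)"
    by (simp add: star_times sweedler_linear[OF linear_star_left])
  finally show ?case .
\<comment> \<open>For \<open>f = 1\<close> both sides are 0: \<open>\<epsilon>\<close> kills
  \<open>circ g (\<iota> y)\<close>, and \<open>star 1 (\<iota> y)\<close> vanishes.\<close>
qed (simp_all add: star_simps star_one_left)

lemma linear_times_left: "Vector_Spaces.linear sT sT (\<lambda>f. f * g)"
  using times_bilinear by (simp add: bilinear_map_def)

text \<open>After \<open>star_circ_iota\<close>, each summand is
  \<open>circ (star f a * b) (\<iota> y)\<close> written out by the derivation rule.\<close>

lemma circ_circ_iota: "circ f (circ g (\<iota> y)) = circ (circ f g) (\<iota> y)"
proof -
  have "circ f (circ g (\<iota> y))
      = Sw sT (\<lambda>a b. star f (circ a (\<iota> y)) * b + star f a * circ b (\<iota> y)) g"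
    by (simp add: circ_product_def[of _ _ _ f] Sw_circ_iota[OF bil_star_times(2)])
  also have "\<dots> = Sw sT (\<lambda>a b. star (star f a * b) (\<iota> y) + star f a * b * \<iota> y) g"
    by (simp only: star_circ_iota) (simp add: circ_iota star_times_iota algebra_simps)
  also have "\<dots> = star (circ f g) (\<iota> y) + circ f g * \<iota> y"
    by (simp add: sweedler_add_fun T.vector_space_axioms circ_product_def
        sweedler_linear[OF linear_star_left] sweedler_linear[OF linear_times_left])
  finally show ?thesis by (simp add: circ_iota)
qed


section \<open>The filtration by word length\<close>

definition W :: "nat \<Rightarrow> 'a set" where
  "W n = T.span (word ` {xs. length xs < n})"

lemma subspace_W: "T.subspace (W n)"
  by (simp add: W_def)

lemma word_mem_W: "length xs < n \<Longrightarrow> word xs \<in> W n"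
  unfolding W_def by (rule T.span_base) simp

lemma W_mono: "m \<le> n \<Longrightarrow> W m \<subseteq> W n"
  unfolding W_def by (rule T.span_mono) auto

text \<open>The strict bound on lengths makes the lowest level zero, so inductions along the
  filtration start trivially.\<close>

lemma W_0: "W 0 = {0}"
  by (simp add: W_def)

lemma W_subset:
  assumes "T.subspace S" "\<And>xs. length xs < n \<Longrightarrow> word xs \<in> S"
  shows "W n \<subseteq> S"
  unfolding W_def using assms by (intro T.span_minimal) auto

lemma linear_W:
  assumes L: "Vector_Spaces.linear sT sT L"
    and "\<And>xs. length xs < n \<Longrightarrow> L (word xs) \<in> W m" "f \<in> W n"
  shows "L f \<in> W m"
proof -
  interpret L: Vector_Spaces.linear sT sT L by fact
  have "W n \<subseteq> L -` W m"
    using assms(2) by (intro W_subset L.subspace_vimage subspace_W) auto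
  then show ?thesis using assms(3) by auto
qed

lemma linear_times_right: "Vector_Spaces.linear sT sT (\<lambda>f. g * f)"
  using times_bilinear by (simp add: bilinear_map_def)

lemma W_iota_times: "f \<in> W n \<Longrightarrow> \<iota> x * f \<in> W (Suc n)"
proof (erule linear_W[OF linear_times_right, rotated])
  show "\<iota> x * word xs \<in> W (Suc n)" if "length xs < n" for xs
    using word_mem_W[of "x # xs" "Suc n"] that by simp
qed

lemma W_times_iota: "f \<in> W n \<Longrightarrow> f * \<iota> x \<in> W (Suc n)"
proof (erule linear_W[OF linear_times_left, rotated])
  show "word xs * \<iota> x \<in> W (Suc n)" if "length xs < n" for xs
    using word_mem_W[of "xs @ [x]" "Suc n"] that by simp
qed

text \<open>The derivation replaces one letter \<open>x\<close> at a time by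
  \<open>starV x y\<close>, which keeps the length; \<open>Suc\<close> reflects the strict bound in
  \<open>W\<close>.\<close>

lemma star_word_iota_mem_W: "star (word xs) (\<iota> y) \<in> W (Suc (length xs))"
proof (induction xs)
  case Nil
  show ?case using T.subspace_0[OF subspace_W] by simp
next
  case (Cons x xs)
  have "\<iota> (starV x y) * word xs \<in> W (Suc (Suc (length xs)))"
    by (intro W_iota_times word_mem_W) simp
  then show ?case
    using W_iota_times[OF Cons.IH, of x] T.subspace_add[OF subspace_W]
    by (simp add: star_times_iota star_iota)
qed

lemma W_star_iota: "f \<in> W n \<Longrightarrow> star f (\<iota> y) \<in> W n"
proof (erule linear_W[OF linear_star_left, rotated])
  show "star (word xs) (\<iota> y) \<in> W n" if "length xs < n" for xs
    using star_word_iota_mem_W[of xs y] W_mono[of "Suc (length xs)" n] that by auto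
qed

lemma ex_W: "\<exists>n. f \<in> W n"
proof (induction f rule: word_induct)
  case (add f g)
  then obtain m n where "f \<in> W m" "g \<in> W n" by blast
  then have "f \<in> W (max m n)" "g \<in> W (max m n)"
    using W_mono[of m "max m n"] W_mono[of n "max m n"] by auto
  then show ?case using T.subspace_add[OF subspace_W] by blast
next
  case (scale c f)
  then show ?case using T.subspace_scale[OF subspace_W] by blast
next
  case (word xs)
  show ?case using word_mem_W[of xs "Suc (length xs)"] by auto
qed

text \<open>\<open>circ f (\<iota> y)\<close> and \<open>f * \<iota> y\<close> differ by a combination of shorter words, so \<open>V\<close> also
  generates the algebra for \<open>circ\<close>.\<close>

lemma circ_induct [case_names add scale one iota]:
  assumes add: "\<And>f g. P f \<Longrightarrow> P g \<Longrightarrow> P (f + g)" and scale: "\<And>c f. P f \<Longrightarrow> P (sT c f)"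
    and one: "P 1" and iota: "\<And>f y. P f \<Longrightarrow> P (circ f (\<iota> y))"
  shows "P h"
proof -
  have sub: "T.subspace {f. P f}"
    using scale[OF one, of 0] by (intro T.subspaceI) (auto simp: add scale)
  have "W n \<subseteq> {f. P f}" for n
  proof (induction n)
    case 0
    then show ?case using T.subspace_0[OF sub] by (simp add: W_0)
  next
    case (Suc n)
    show ?case
    proof (rule W_subset[OF sub])
      fix xs :: "'v list" assume len: "length xs < Suc n"
      show "word xs \<in> {f. P f}"
      proof (cases xs rule: rev_cases)
        case Nil
        then show ?thesis by (simp add: one)
      next
        case (snoc ys y)
        then have "word ys \<in> W n" "star (word ys) (\<iota> y) \<in> W n"
          using len by (auto intro: word_mem_W W_star_iota)
        then have "P (word ys)" "P (star (word ys) (\<iota> y))" using Suc by auto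
        then have "circ (word ys) (\<iota> y) - star (word ys) (\<iota> y) \<in> {f. P f}"
          using iota by (intro T.subspace_diff[OF sub]) auto
        then show ?thesis by (simp add: snoc circ_iota)
      qed
    qed
  qed
  then show ?thesis using ex_W[of h] by auto
qed

section \<open>Algebra and coalgebra properties of \<open>circ\<close>\<close>

lemma circ_assoc: "circ (circ f g) h = circ f (circ g h)"
  by (induction h rule: circ_induct) (simp_all add: circ_simps circ_circ_iota)

text \<open>Together with \<open>star f 1 = f\<close> this makes \<open>star\<close> a right action
  of the algebra with product \<open>circ\<close>. It is the source of the first post-Lie
  identity.\<close>

lemma star_circ: "star f (circ g h) = star (star f g) h"
  by (induction h rule: circ_induct)
     (simp_all add: circ_simps star_simps circ_circ_iota star_circ_iota star_one_right)

lemma counit_circ: "\<epsilon> (circ f g) = \<epsilon> f * \<epsilon> g"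
  by (induction g rule: circ_induct)
     (simp_all add: circ_simps counit_simps circ_circ_iota algebra_simps)

text \<open>The map \<open>F\<close> is generalized because a last factor \<open>\<iota> y\<close>
  turns it into the sum of its two modifications by \<open>circ\<close> with
  \<open>\<iota> y\<close>.\<close>

lemma Sw_circ:
  assumes "bil s F"
  shows "Sw s F (circ f g) = Sw s (\<lambda>a b. Sw s (\<lambda>c d. F (circ a c) (circ b d)) g) f"
  using assms
proof (induction g arbitrary: F rule: circ_induct)
  have bil: "bil s (\<lambda>c d. F (circ a c) (circ b d))"
    and bil_y: "bil s (\<lambda>a b. F (circ a (\<iota> y)) b + F a (circ b (\<iota> y)))"
    if F: "bil s F" for F a b y
    using bilD[OF F]
    by (intro bilI; simp add: circ_simps
        vector_space.vector_space_assms(1)[OF bilD(1)[OF F]])+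
  {
    case (add g h)
    note vs = bilD(1)[OF add.prems]
    show ?case
      by (simp add: circ_simps Sw_add[OF add.prems] Sw_add[OF bil[OF add.prems]]
          sweedler_add_fun[OF vs] add.IH[OF add.prems])
  next
    case (scale c g)
    note vs = bilD(1)[OF scale.prems]
    show ?case
      by (simp add: circ_simps Sw_scale[OF scale.prems] Sw_scale[OF bil[OF scale.prems]]
          sweedler_scale_fun[OF vs] scale.IH[OF scale.prems])
  next
    case one
    show ?case by (simp add: Sw_one[OF bil[OF one.prems]])
  next
    case (iota g y)
    note F = iota.prems
    have "Sw s F (circ f (circ g (\<iota> y))) =
        Sw s (\<lambda>a b. F (circ a (\<iota> y)) b + F a (circ b (\<iota> y))) (circ f g)"
      by (simp only: circ_circ_iota Sw_circ_iota[OF F])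
    also have "\<dots> = Sw s (\<lambda>a b. Sw s (\<lambda>c d. F (circ a c) (circ b d)) (circ g (\<iota> y))) f"
      by (simp only: iota.IH[OF bil_y[OF F]] Sw_circ_iota[OF bil[OF F]] circ_circ_iota)
    finally show ?case .
  }
qed

subsection \<open>The isomorphism\<close>

lemma multilinear_foldr_circ: "multilinear sV sT (\<lambda>xs. foldr circ (map \<iota> xs) 1)"
  unfolding multilinear_def
proof (intro allI)
  fix u w :: "'v list"
  show "Vector_Spaces.linear sV sT (\<lambda>x. foldr circ (map \<iota> (u @ x # w)) 1)"
    unfolding Vector_Spaces.linear_iff
    using V.vector_space_axioms T.vector_space_axioms
    by (induction u) (simp_all add: linear_iota circ_simps)
qed

text \<open>Existence comes from \<open>word_lift\<close>; the words span, so the choice is between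
  equal maps.\<close>

definition phi :: "'a \<Rightarrow> 'a" where
  "phi = (SOME \<phi>. Vector_Spaces.linear sT sT \<phi> \<and>
     (\<forall>xs. \<phi> (word xs) = foldr circ (map \<iota> xs) 1))"

lemma linear_phi: "Vector_Spaces.linear sT sT phi"
  and phi_word: "phi (word xs) = foldr circ (map \<iota> xs) 1"
proof -
  have "\<exists>\<phi>. Vector_Spaces.linear sT sT \<phi> \<and> (\<forall>xs. \<phi> (word xs) = foldr circ (map \<iota> xs) 1)"
    using word_lift[OF multilinear_foldr_circ] by metis
  from someI_ex[OF this, folded phi_def]
  show "Vector_Spaces.linear sT sT phi" "phi (word xs) = foldr circ (map \<iota> xs) 1"
    by auto
qed

lemma phi_simps:
  "phi (f + g) = phi f + phi g" "phi (f - g) = phi f - phi g" "phi (sT c f) = sT c (phi f)"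
  "phi 0 = 0"
proof -
  interpret P: Vector_Spaces.linear sT sT phi by (rule linear_phi)
  show "phi (f + g) = phi f + phi g" "phi (f - g) = phi f - phi g"
    "phi (sT c f) = sT c (phi f)" "phi 0 = 0"
    by (simp_all add: P.add P.diff P.scale P.zero)
qed

lemma phi_one [simp]: "phi 1 = 1"
  using phi_word[of "[]"] by simp

lemma phi_iota [simp]: "phi (\<iota> x) = \<iota> x"
  using phi_word[of "[x]"] by simp

lemma phi_iota_times: "phi (\<iota> x * f) = circ (\<iota> x) (phi f)"
proof (induction f rule: word_induct)
  case (word xs)
  show ?case using phi_word[of "x # xs"] phi_word[of xs] by simp
qed (simp_all add: distrib_left mult_scale phi_simps circ_simps)

text \<open>The iterated product on words directly handles one letter on the left; associativity of
  \<open>circ\<close> extends this to all left factors.\<close>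

lemma phi_times: "phi (f * g) = circ (phi f) (phi g)"
  by (induction f rule: left_induct)
     (simp_all add: distrib_right mult_scale phi_simps circ_simps mult.assoc phi_iota_times
       circ_assoc)

lemma counit_phi: "\<epsilon> (phi f) = \<epsilon> f"
  by (induction f rule: right_induct) (simp_all add: phi_simps counit_simps phi_times)

text \<open>This is compatibility with the coproduct: right multiplication by
  \<open>\<iota> y\<close> follows the same two-term rule for both products, and \<open>phi\<close>
  exchanges them.\<close>

lemma Sw_phi:
  assumes "bil s F"
  shows "Sw s F (phi h) = Sw s (\<lambda>a b. F (phi a) (phi b)) h"
  using assms
proof (induction h arbitrary: F rule: right_induct)
  have bil: "bil s (\<lambda>a b. F (phi a) (phi b))"
    and bil_y: "bil s (\<lambda>a b. F (circ a (\<iota> y)) b + F a (circ b (\<iota> y)))"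
    if F: "bil s F" for F y
    using bilD[OF F]
    by (intro bilI; simp add: circ_simps phi_simps
        vector_space.vector_space_assms(1)[OF bilD(1)[OF F]])+
  {
    case (add f g)
    then show ?case by (simp add: phi_simps Sw_add[OF add.prems] Sw_add[OF bil])
  next
    case (scale c f)
    then show ?case by (simp add: phi_simps Sw_scale[OF scale.prems] Sw_scale[OF bil])
  next
    case one
    then show ?case by (simp add: Sw_one[OF one.prems] Sw_one[OF bil])
  next
    case (iota f y)
    note F = iota.prems
    have "Sw s F (phi (f * \<iota> y))
        = Sw s (\<lambda>a b. F (circ a (\<iota> y)) b + F a (circ b (\<iota> y))) (phi f)"
      by (simp only: phi_times phi_iota Sw_circ_iota[OF F])
    also have "\<dots> = Sw s (\<lambda>a b. F (phi a) (phi b)) (f * \<iota> y)"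
      by (simp only: iota.IH[OF bil_y[OF F]] Sw_times_iota[OF bil[OF F]] phi_times phi_iota)
    finally show ?case .
  }
qed

text \<open>Appending \<open>y\<close> produces \<open>phi (word xs) * \<iota> y\<close>, correct up
  to shorter words by induction, plus \<open>star (phi (word xs)) (\<iota> y)\<close>, whose words
  have at most the length of \<open>xs\<close>.\<close>

lemma phi_word_diff: "phi (word xs) - word xs \<in> W (length xs)"
proof (induction xs rule: rev_induct)
  case Nil
  show ?case using T.subspace_0[OF subspace_W] by simp
next
  case (snoc y xs)
  have xs: "word xs \<in> W (Suc (length xs))" by (rule word_mem_W) simp
  have "phi (word xs) - word xs \<in> W (Suc (length xs))"
    using snoc W_mono[of "length xs" "Suc (length xs)"] by auto
  from T.subspace_add[OF subspace_W this xs] have "phi (word xs) \<in> W (Suc (length xs))"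
    by simp
  then have "star (phi (word xs)) (\<iota> y) \<in> W (Suc (length xs))"
    by (rule W_star_iota)
  from T.subspace_add[OF subspace_W W_times_iota[OF snoc, of y] this]
  show ?case by (simp add: phi_times circ_iota algebra_simps)
qed

lemma phi_diff_mem_W: "f \<in> W (Suc n) \<Longrightarrow> phi f - f \<in> W n"
proof (erule linear_W[rotated 2])
  show "Vector_Spaces.linear sT sT (\<lambda>f. phi f - f)"
    unfolding Vector_Spaces.linear_iff using T.vector_space_axioms
    by (simp add: phi_simps T.scale_right_diff_distrib)
  show "phi (word xs) - word xs \<in> W n" if "length xs < Suc n" for xs
    using phi_word_diff[of xs] W_mono[of "length xs" n] that by auto
qed

lemma inj_phi: "inj phi"
proof -
  have "f = 0" if "f \<in> W n" "phi f = 0" for f n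
    using that
  proof (induction n)
    case (Suc n)
    \<comment> \<open>With \<open>phi f = 0\<close> the difference \<open>phi f - f\<close> is
      \<open>- f\<close>, so a kernel element drops one level at a time down to 0.\<close>
    then have "- f \<in> W n" using phi_diff_mem_W[of f n] by simp
    then show ?case using T.subspace_neg[OF subspace_W, of "- f" n] Suc by simp
  qed (simp add: W_0)
  then have "f = 0" if "phi f = 0" for f using ex_W[of f] that by auto
  then show ?thesis
    by (intro injI) (metis phi_simps(2) right_minus_eq)
qed

text \<open>The error \<open>phi f - f\<close> stays in \<open>L\<close> and lies one level lower,
  so by induction it is \<open>phi l\<close> with \<open>l\<close> in \<open>L\<close>, and
  \<open>f = phi (f - l)\<close>. The cases needed are the whole algebra and
  \<open>Lie\<close>.\<close>

lemma phi_image_subspace: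
  assumes L: "T.subspace L" and sub: "phi ` L \<subseteq> L"
  shows "phi ` L = L"
proof
  have "f \<in> phi ` L" if "f \<in> L" "f \<in> W n" for f n
    using that
  proof (induction n arbitrary: f)
    case 0
    then show ?case using T.subspace_0[OF L] phi_simps(4) by (force simp: W_0)
  next
    case (Suc n)
    have "phi f - f \<in> L" using Suc.prems sub T.subspace_diff[OF L] by blast
    then obtain l where l: "l \<in> L" "phi f - f = phi l"
      using Suc.IH phi_diff_mem_W[OF Suc.prems(2)] by blast
    then have "f = phi (f - l)" by (simp add: phi_simps algebra_simps)
    then show ?case using T.subspace_diff[OF L Suc.prems(1) l(1)] by blast
  qed
  then show "L \<subseteq> phi ` L" using ex_W by blast
qed (rule sub)

lemma bij_phi: "bij phi"
  using inj_phi phi_image_subspace[of UNIV] by (simp add: bij_def)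


subsection \<open>Hopf algebra structures\<close>

lemma ex_antipode:
  obtains S where "Vector_Spaces.linear sT sT S" "S 1 = 1"
    "\<And>x f. S (\<iota> x * f) = - (S f * \<iota> x)" "\<And>f y. S (f * \<iota> y) = - (\<iota> y * S f)"
proof -
  \<comment> \<open>The antipode for concatenation reverses a word and changes sign once per
    letter.\<close>
  let ?G = "\<lambda>xs. sT ((- 1) ^ length xs) (word (rev xs))"
  have "multilinear sV sT ?G"
    unfolding multilinear_def Vector_Spaces.linear_iff
    using V.vector_space_axioms T.vector_space_axioms
    by (simp add: linear_iota distrib_left distrib_right mult_scale T.scale_right_distrib
        mult.commute)
  then obtain S where S: "Vector_Spaces.linear sT sT S" "\<And>xs. S (word xs) = ?G xs"
    using word_lift by blast
  interpret S: Vector_Spaces.linear sT sT S by fact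
  have "S (\<iota> x * f) = - (S f * \<iota> x)" for x f
  proof (induction f rule: word_induct)
    case (word xs)
    show ?case using S(2)[of "x # xs"] S(2)[of xs] by (simp add: mult_scale)
  qed (simp_all add: distrib_left distrib_right mult_scale S.add S.scale)
  moreover have "S (f * \<iota> y) = - (\<iota> y * S f)" for f y
  proof (induction f rule: word_induct)
    case (word xs)
    show ?case using S(2)[of "xs @ [y]"] S(2)[of xs] by (simp add: mult_scale)
  qed (simp_all add: distrib_left distrib_right mult_scale S.add S.scale)
  moreover have "S 1 = 1" using S(2)[of "[]"] by simp
  ultimately show ?thesis using that S(1) by blast
qed

text \<open>The two terms produced by a letter cancel inside the sum when the letter ends up between
  the factors: a first letter for \<open>S a * b\<close>, a last letter for \<open>a * S b\<close>.
  Hence the two different inductions.\<close>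

lemma antipode:
  "\<exists>S. Vector_Spaces.linear sT sT S \<and>
    (\<forall>h. Sw sT (\<lambda>a b. S a * b) h = sT (\<epsilon> h) 1 \<and> Sw sT (\<lambda>a b. a * S b) h = sT (\<epsilon> h) 1)"
proof -
  obtain S where S: "Vector_Spaces.linear sT sT S" "S 1 = 1"
    "\<And>x f. S (\<iota> x * f) = - (S f * \<iota> x)" "\<And>f y. S (f * \<iota> y) = - (\<iota> y * S f)"
    using ex_antipode by blast
  interpret S: Vector_Spaces.linear sT sT S by fact
  have bil: "bil sT (\<lambda>a b. S a * b)" "bil sT (\<lambda>a b. a * S b)"
    using T.vector_space_axioms
    by (intro bilI; simp add: distrib_left distrib_right mult_scale S.add S.scale)+
  have "Sw sT (\<lambda>a b. S a * b) h = sT (\<epsilon> h) 1" for h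
  proof (induction h rule: left_induct)
    case (iota x f)
    then show ?case
      by (simp add: Sw_iota_times[OF bil(1)] S mult.assoc sweedler_zero_fun[OF T.vector_space_axioms])
  qed (simp_all add: Sw_add[OF bil(1)] Sw_scale[OF bil(1)] Sw_one[OF bil(1)] S(2) counit_simps
      T.scale_left_distrib)
  moreover have "Sw sT (\<lambda>a b. a * S b) h = sT (\<epsilon> h) 1" for h
  proof (induction h rule: right_induct)
    case (iota f y)
    then show ?case
      by (simp add: Sw_times_iota[OF bil(2)] S mult.assoc sweedler_zero_fun[OF T.vector_space_axioms])
  qed (simp_all add: Sw_add[OF bil(2)] Sw_scale[OF bil(2)] Sw_one[OF bil(2)] S(2) counit_simps
      T.scale_left_distrib)
  ultimately show ?thesis using S(1) by blast
qed

text \<open>The antipode for concatenation is conjugated by \<open>phi\<close>, which respects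
  products, coproduct and counit.\<close>

lemma circ_antipode:
  "\<exists>S. Vector_Spaces.linear sT sT S \<and>
    (\<forall>h. Sw sT (\<lambda>a b. circ (S a) b) h = sT (\<epsilon> h) 1 \<and>
         Sw sT (\<lambda>a b. circ a (S b)) h = sT (\<epsilon> h) 1)"
proof -
  obtain S where S: "Vector_Spaces.linear sT sT S"
    "\<And>h. Sw sT (\<lambda>a b. S a * b) h = sT (\<epsilon> h) 1" "\<And>h. Sw sT (\<lambda>a b. a * S b) h = sT (\<epsilon> h) 1"
    using antipode by blast
  interpret S: Vector_Spaces.linear sT sT S by fact
  interpret P: Vector_Spaces.linear sT sT phi by (rule linear_phi)
  define R where "R h = phi (S (inv phi h))" for h
  have R: "R (phi h) = phi (S h)" for h
    by (simp add: R_def inj_phi)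
  have surj: "\<exists>k. h = phi k" for h
    using bij_phi by (metis bij_pointE)
  have R_add: "R (f + g) = R f + R g" for f g
  proof -
    obtain a b where "f = phi a" "g = phi b" using surj by meson
    then show ?thesis using R[of "a + b"] by (simp add: R S.add P.add)
  qed
  have R_scale: "R (sT c f) = sT c (R f)" for c f
  proof -
    obtain a where "f = phi a" using surj by meson
    then show ?thesis using R[of "sT c a"] by (simp add: R S.scale P.scale)
  qed
  have lin: "Vector_Spaces.linear sT sT R"
    unfolding Vector_Spaces.linear_iff using T.vector_space_axioms R_add R_scale by blast
  have bil: "bil sT (\<lambda>a b. circ (R a) b)" "bil sT (\<lambda>a b. circ a (R b))"
    using T.vector_space_axioms by (intro bilI; simp add: circ_simps R_add R_scale)+
  have "Sw sT (\<lambda>a b. circ (R a) b) (phi h) = sT (\<epsilon> (phi h)) 1 \<and>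
      Sw sT (\<lambda>a b. circ a (R b)) (phi h) = sT (\<epsilon> (phi h)) 1" for h
    unfolding Sw_phi[OF bil(1)] Sw_phi[OF bil(2)] R
    unfolding phi_times[symmetric] sweedler_linear[OF linear_phi, symmetric] S counit_phi
    by (simp add: phi_simps)
  then show ?thesis using lin surj by metis
qed

section \<open>From scalar identities to equalities of tensors\<close>

lemma bil_of_multilinear:
  assumes "multilinear sT s G"
  shows "bil s (\<lambda>a b. G [a, b])" "bil s (\<lambda>b c. G [a, b, c])" "bil s (\<lambda>a c. G [a, b, c])"
  using multilinearD(1)[OF assms, of "[]"] multilinearD(1)[OF assms, of "[x]" for x]
    multilinearD(1)[OF assms, of "[x, y]" for x y]
    multilinearD(2)[OF assms, of "[]"] multilinearD(2)[OF assms, of "[x]" for x]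
    multilinearD(2)[OF assms, of "[x, y]" for x y] multilinearD(4)[OF assms]
  by (intro bilI; simp)+

lemma linear_coproduct:
  assumes "Vector_Spaces.linear fscale s l"
  shows "l (\<Delta> h) = Sw s (\<lambda>a b. l (tens2 a b)) h"
proof -
  have "l (\<Delta> h) = lin_ext s (\<lambda>w. l (Poly_Mapping.single w 1)) (\<Delta> h)"
    using linear_lin_ext_comp[OF assms, of "\<lambda>w. Poly_Mapping.single w 1" "\<Delta> h"]
    by (simp add: poly_mapping_lin_ext_single)
  also have "\<dots> = Sw s (\<lambda>a b. l (tens2 a b)) h"
    unfolding sweedler_def
  proof (rule lin_ext_cong)
    fix w assume "w \<in> Poly_Mapping.keys (\<Delta> h)"
    then have "length w = 2" using linear_into by (auto simp: linear_into_tens2_def)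
    then have "w = [w ! 0, w ! 1]"
      by (cases w; cases "tl w") auto
    then show "l (Poly_Mapping.single w 1) = l (tens2 (w ! 0) (w ! 1))" by simp
  qed
  finally show ?thesis .
qed

lemma coalgebra: "coalgebra_over sT \<Delta> \<epsilon>"
  unfolding coalgebra_over_def
proof (intro conjI allI)
  fix h
  show "tensor_eq sT
        (sweedler fscale (\<lambda>a b. sweedler fscale (\<lambda>a1 a2. tens3 a1 a2 b) (\<Delta> a)) (\<Delta> h))
        (sweedler fscale (\<lambda>a b. sweedler fscale (\<lambda>b1 b2. tens3 a b1 b2) (\<Delta> b)) (\<Delta> h))"
  proof (rule tensor_eqI[OF T.vector_space_axioms])
    fix l :: "('a list \<Rightarrow>\<^sub>0 'k) \<Rightarrow> 'k"
    assume l: "Vector_Spaces.linear fscale (*) l"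
      and "multilinear sT (*) (\<lambda>w. l (Poly_Mapping.single w 1))"
    from bil_of_multilinear(2,3)[OF this(2)]
    show "l (sweedler fscale (\<lambda>a b. sweedler fscale (\<lambda>a1 a2. tens3 a1 a2 b) (\<Delta> a)) (\<Delta> h)) =
      l (sweedler fscale (\<lambda>a b. sweedler fscale (\<lambda>b1 b2. tens3 a b1 b2) (\<Delta> b)) (\<Delta> h))"
      unfolding sweedler_linear[OF l] 
      by (rule Sw_coassoc[OF vector_space_times, of "\<lambda>a b c. l (tens3 a b c)"])
  qed
qed (rule T.vector_space_axioms linear_into linear_counit Sw_counit_left Sw_counit_right)+

text \<open>By \<open>tensor_eqI\<close> scalar-valued \<open>F\<close> suffice, so
  \<open>Sw_circ\<close> yields multiplicativity of the coproduct itself.\<close>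

lemma tensor_eq_tens_mult:
  assumes "\<And>F :: 'a \<Rightarrow> 'a \<Rightarrow> 'k. bil (*) F \<Longrightarrow>
    Sw (*) F h = Sw (*) (\<lambda>a b. Sw (*) (\<lambda>c d. F (m a c) (m b d)) g) f"
  shows "tensor_eq sT (\<Delta> h) (tens_mult m (\<Delta> f) (\<Delta> g))"
proof (rule tensor_eqI[OF T.vector_space_axioms])
  fix l :: "('a list \<Rightarrow>\<^sub>0 'k) \<Rightarrow> 'k"
  assume l: "Vector_Spaces.linear fscale (*) l"
    and "multilinear sT (*) (\<lambda>w. l (Poly_Mapping.single w 1))"
  from assms[OF bil_of_multilinear(1)[OF this(2)]]
  show "l (\<Delta> h) = l (tens_mult m (\<Delta> f) (\<Delta> g))"
    by (simp add: tens_mult_def sweedler_linear[OF l] linear_coproduct[OF l])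
qed

lemma hopf_times: "hopf_algebra sT (*) 1 \<Delta> \<epsilon>"
  unfolding hopf_algebra_def algebra_over_def
  using coproduct
  by (auto simp: deshuffling_coproduct_def T.vector_space_axioms times_bilinear coalgebra
      mult.assoc counit_times counit_simps antipode)

lemma hopf_circ: "hopf_algebra sT circ 1 \<Delta> \<epsilon>"
  unfolding hopf_algebra_def algebra_over_def
  using coproduct tensor_eq_tens_mult[OF Sw_circ]
  by (auto simp: deshuffling_coproduct_def T.vector_space_axioms bil_circ coalgebra
      circ_assoc counit_circ counit_simps circ_antipode)

lemma hopf_isomorphism_phi:
  "hopf_isomorphism sT (*) 1 \<Delta> \<epsilon> sT circ 1 \<Delta> \<epsilon> phi"
proof -
  have "tensor_eq sT (\<Delta> (phi h)) (sweedler fscale (\<lambda>a b. tens2 (phi a) (phi b)) (\<Delta> h))" for h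
  proof (rule tensor_eqI[OF T.vector_space_axioms])
    fix l :: "('a list \<Rightarrow>\<^sub>0 'k) \<Rightarrow> 'k"
    assume l: "Vector_Spaces.linear fscale (*) l"
      and "multilinear sT (*) (\<lambda>w. l (Poly_Mapping.single w 1))"
    from Sw_phi[OF bil_of_multilinear(1)[OF this(2)]]
    show "l (\<Delta> (phi h)) = l (sweedler fscale (\<lambda>a b. tens2 (phi a) (phi b)) (\<Delta> h))"
      by (simp add: sweedler_linear[OF l] linear_coproduct[OF l])
  qed
  then show ?thesis
    by (simp add: hopf_isomorphism_def hopf_times hopf_circ linear_phi bij_phi phi_times counit_phi)
qed

subsection \<open>The free Lie algebra\<close>

abbreviation Lie :: "'a set" where
  "Lie \<equiv> free_lie sT \<iota>"

lemma subspace_Lie: "T.subspace Lie"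
  unfolding free_lie_def by (rule T.subspace_Inter) auto

lemma iota_mem_Lie: "\<iota> x \<in> Lie"
  and commutator_mem_Lie: "f \<in> Lie \<Longrightarrow> g \<in> Lie \<Longrightarrow> commutator f g \<in> Lie"
  unfolding free_lie_def by auto

lemmas Lie_closed = T.subspace_add[OF subspace_Lie] T.subspace_diff[OF subspace_Lie]
  T.subspace_scale[OF subspace_Lie] commutator_mem_Lie

text \<open>The elements of \<open>Lie\<close> satisfying \<open>P\<close> form one of the
  subalgebras being intersected. Staying inside \<open>Lie\<close> supplies the membership premises
  of the commutator case.\<close>

lemma Lie_induct [consumes 1, case_names add scale iota commutator]:
  assumes "h \<in> Lie"
    and add: "\<And>f g. P f \<Longrightarrow> P g \<Longrightarrow> P (f + g)" and scale: "\<And>c f. P f \<Longrightarrow> P (sT c f)"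
    and iota: "\<And>x. P (\<iota> x)"
    and commutator: "\<And>f g. f \<in> Lie \<Longrightarrow> g \<in> Lie \<Longrightarrow> P f \<Longrightarrow> P g \<Longrightarrow> P (commutator f g)"
  shows "P h"
proof -
  have "T.subspace {f \<in> Lie. P f}"
    using scale[OF iota, of 0] T.subspace_0[OF subspace_Lie]
    by (intro T.subspaceI) (auto simp: add scale Lie_closed)
  then have "Lie \<subseteq> {f \<in> Lie. P f}"
    by (subst free_lie_def) (rule Inter_lower, auto simp: iota commutator iota_mem_Lie Lie_closed)
  then show ?thesis using assms(1) by auto
qed

text \<open>Elements of the free Lie algebra are primitive, tested against bilinear maps. Primitive
  elements therefore obey the same rules under \<open>star\<close> and \<open>circ\<close> as
  letters.\<close>

lemma Sw_Lie:
  assumes "f \<in> Lie" "bil s F"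
  shows "Sw s F f = F f 1 + F 1 f"
  using assms
proof (induction f arbitrary: F rule: Lie_induct)
  case (add f g)
  then show ?case by (simp add: Sw_add bilD(2,3)[OF add.prems])
next
  case (scale c f)
  show ?case
    by (simp add: Sw_scale[OF scale.prems] scale.IH[OF scale.prems] bilD(4,5)[OF scale.prems]
        vector_space.vector_space_assms(1)[OF bilD(1)[OF scale.prems]])
next
  case (iota x)
  then show ?case by (rule Sw_iota)
next
  case (commutator f g)
  note F = bilD[OF commutator.prems]
  have sub: "F (a - b) c = F a c - F b c" "F a (b - c) = F a b - F a c" for a b c
    using F(2)[of "a - b" b c] F(3)[of a "b - c" c] by (simp_all add: algebra_simps)
  \<comment> \<open>The mixed terms are symmetric in \<open>a\<close> and \<open>b\<close>, hence
    cancel in the commutator.\<close>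
  have times: "Sw s F (a * b) = F (a * b) 1 + F a b + F b a + F 1 (a * b)"
    if a: "\<And>G. bil s G \<Longrightarrow> Sw s G a = G a 1 + G 1 a"
      and b: "\<And>G. bil s G \<Longrightarrow> Sw s G b = G b 1 + G 1 b" for a b
  proof -
    have "bil s (\<lambda>u v. F (u * b) v + F u (v * b))"
      using F by (intro bilI)
        (simp_all add: distrib_right mult_scale vector_space.vector_space_assms(1)[OF F(1)])
    then show ?thesis
      by (simp add: Sw_times[OF commutator.prems] b[OF bil_times[OF commutator.prems]] a add.assoc)
  qed
  have "Sw s F (f * g) = Sw s F (commutator f g) + Sw s F (g * f)"
    by (simp add: commutator_def flip: Sw_add[OF commutator.prems])
  then have diff: "Sw s F (commutator f g) = Sw s F (f * g) - Sw s F (g * f)" by simp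
  show ?case
    unfolding diff times[of f g, OF commutator.IH, simplified] times[of g f, OF commutator.IH(2,1), simplified]
    by (simp add: commutator_def sub)
qed

lemma circ_Lie: "g \<in> Lie \<Longrightarrow> circ f g = star f g + f * g"
  by (simp add: circ_product_def Sw_Lie[OF _ bil_star_times(2)] star_one_right)

lemma star_times_Lie: "h \<in> Lie \<Longrightarrow> star (f * g) h = star f h * g + f * star g h"
  by (simp add: star_times Sw_Lie[OF _ bil_star_times(1)] star_one_right)

lemma star_diff: "star (f - g) h = star f h - star g h" "star f (g - h) = star f g - star f h"
  using star_simps(1)[of "f - g" g h] star_simps(2)[of f "g - h" h] by (simp_all add: algebra_simps)

lemma circ_diff: "circ (f - g) h = circ f h - circ g h" "circ f (g - h) = circ f g - circ f h"
  using circ_simps(1)[of "f - g" g h] circ_simps(2)[of f "g - h" h] by (simp_all add: algebra_simps)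

lemma star_commutator:
  "h \<in> Lie \<Longrightarrow> star (commutator f g) h = commutator (star f h) g + commutator f (star g h)"
  by (simp add: commutator_def star_diff star_times_Lie algebra_simps)

text \<open>Acting by a letter is a derivation that maps letters to letters, so it preserves
  \<open>Lie\<close>. A general right argument is built by \<open>circ\<close> with letters, and
  \<open>star_circ_iota\<close> reduces it to successive letter actions.\<close>

lemma star_mem_Lie:
  assumes "f \<in> Lie"
  shows "star f g \<in> Lie"
proof -
  have *: "star f (\<iota> y) \<in> Lie" if "f \<in> Lie" for f y
    using that
    by (induction rule: Lie_induct)
       (simp_all add: star_simps star_iota iota_mem_Lie Lie_closed star_commutator)
  show ?thesis
    by (induction g rule: circ_induct)
       (simp_all add: assms star_simps star_circ_iota star_one_right Lie_closed *)
qed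

lemma second_bracket_Lie:
  "f \<in> Lie \<Longrightarrow> g \<in> Lie \<Longrightarrow> second_bracket commutator star f g = circ f g - circ g f"
  by (simp add: second_bracket_def commutator_def circ_Lie)

lemma second_bracket_mem_Lie:
  "f \<in> Lie \<Longrightarrow> g \<in> Lie \<Longrightarrow> second_bracket commutator star f g \<in> Lie"
  by (simp add: second_bracket_def Lie_closed star_mem_Lie)

section \<open>Lie and post-Lie structures\<close>

lemma lie_algebra_commutator: "lie_algebra_on sT Lie commutator"
  unfolding lie_algebra_on_def bilinear_product_on_def
  using T.vector_space_axioms subspace_Lie commutator_mem_Lie
  by (auto simp: commutator_def algebra_simps mult_scale T.scale_right_diff_distrib)

lemma post_lie: "post_lie_algebra_on sT Lie commutator star"
  unfolding post_lie_algebra_on_def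
proof (intro conjI ballI)
  show "bilinear_product_on sT Lie star"
    by (simp add: bilinear_product_on_def star_mem_Lie star_simps)
  fix x y z assume mem: "x \<in> Lie" "y \<in> Lie" "z \<in> Lie"
  \<comment> \<open>For primitive \<open>h\<close> the product \<open>g * h\<close> is
    \<open>circ g h - star g h\<close>; applying \<open>star_circ\<close> extends the rule assumed
    for letters. Antisymmetrizing gives the post-Lie identity.\<close>
  have "star x (g * h) = star (star x g) h - star x (star g h)" if "h \<in> Lie" for g h
    using star_circ[of x g h] that by (simp add: circ_Lie star_simps algebra_simps)
  then show "star x (commutator y z) =
      star (star x y) z - star x (star y z) - star (star x z) y + star x (star z y)"
    using mem by (simp add: commutator_def star_diff)
  show "star (commutator x y) z = commutator (star x z) y + commutator x (star y z)"
    using mem by (simp add: star_commutator)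
qed (rule lie_algebra_commutator)

lemma lie_algebra_second_bracket: "lie_algebra_on sT Lie (second_bracket commutator star)"
proof -
  let ?br = "second_bracket commutator star"
  have "?br x (?br y z) + ?br y (?br z x) + ?br z (?br x y) = 0"
    if "x \<in> Lie" "y \<in> Lie" "z \<in> Lie" for x y z
  proof -
    \<comment> \<open>On \<open>Lie\<close> the bracket is the commutator of the associative
      \<open>circ\<close>, so the Jacobi sum cancels termwise.\<close>
    have *: "?br x (?br y z) =
        circ x (circ y z) - circ x (circ z y) - (circ y (circ z x) - circ z (circ y x))"
      if "x \<in> Lie" "y \<in> Lie" "z \<in> Lie" for x y z
    proof -
      have "?br x (?br y z) = circ x (?br y z) - circ (?br y z) x"
        using that by (intro second_bracket_Lie second_bracket_mem_Lie)
      then show ?thesis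
        using that by (simp add: second_bracket_Lie circ_diff circ_assoc)
    qed
    show ?thesis using that by (simp add: *)
  qed
  moreover have "bilinear_product_on sT Lie ?br"
    unfolding bilinear_product_on_def
    by (auto simp: second_bracket_mem_Lie)
       (simp_all add: second_bracket_def commutator_def algebra_simps mult_scale star_simps
         T.scale_right_diff_distrib T.scale_right_distrib)
  ultimately show ?thesis
    by (simp add: lie_algebra_on_def T.vector_space_axioms subspace_Lie)
       (simp add: second_bracket_def commutator_def)
qed

lemma phi_commutator: "phi (commutator f g) = circ (phi f) (phi g) - circ (phi g) (phi f)"
  by (simp add: commutator_def phi_simps phi_times)

lemma phi_Lie: "phi ` Lie = Lie"
proof (rule phi_image_subspace[OF subspace_Lie], safe)
  show "phi f \<in> Lie" if "f \<in> Lie" for f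
    using that
  proof (induction rule: Lie_induct)
    \<comment> \<open>The image is the \<open>circ\<close> commutator of two elements of
      \<open>Lie\<close>, that is, their second bracket, which stays in \<open>Lie\<close>.\<close>
    case (commutator f g)
    then show ?case
      using second_bracket_mem_Lie[of "phi f" "phi g"] second_bracket_Lie[of "phi f" "phi g"]
      by (simp add: phi_commutator)
  qed (simp_all add: phi_simps Lie_closed iota_mem_Lie)
qed

text \<open>Since \<open>phi\<close> carries the commutator to the second bracket, an isomorphism
  starting from the second bracket is its inverse.\<close>

lemma lie_isomorphism_phi_inv:
  "lie_isomorphism_on sT Lie (second_bracket commutator star) sT Lie commutator (inv phi)"
proof -
  have inv: "inv phi (phi f) = f" for f by (simp add: inj_phi)
  have phi_inv: "phi (inv phi f) = f" for f by (simp add: bij_phi bij_is_surj surj_f_inv_f)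
  have "bij_betw (inv phi) Lie Lie"
    using bij_betw_imageI[OF inj_on_inv_into[of Lie phi UNIV]] bij_phi phi_Lie
      image_inv_f_f[OF inj_phi, of Lie] by (simp add: bij_is_surj)
  moreover have "inv phi (f + g) = inv phi f + inv phi g" for f g
    using inv[of "inv phi f + inv phi g"] by (simp add: phi_simps phi_inv)
  moreover have "inv phi (sT c f) = sT c (inv phi f)" for c f
    using inv[of "sT c (inv phi f)"] by (simp add: phi_simps phi_inv)
  moreover have "inv phi (second_bracket commutator star f g) = commutator (inv phi f) (inv phi g)"
    if "f \<in> Lie" "g \<in> Lie" for f g
    using inv[of "commutator (inv phi f) (inv phi g)"] that
    by (simp add: phi_commutator phi_inv second_bracket_Lie)
  ultimately show ?thesis
    by (simp add: lie_isomorphism_on_def lie_algebra_commutator lie_algebra_second_bracket)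
qed

end


theorem proposition2:
  fixes sV :: "'k::field \<Rightarrow> 'v::ab_group_add \<Rightarrow> 'v"
    and sT :: "'k \<Rightarrow> 'a::ring_1 \<Rightarrow> 'a"
    and \<iota> :: "'v \<Rightarrow> 'a"
    and \<Delta> :: "'a \<Rightarrow> ('a list \<Rightarrow>\<^sub>0 'k)"
    and \<epsilon> :: "'a \<Rightarrow> 'k"
    and starV :: "'v \<Rightarrow> 'v \<Rightarrow> 'v"
    and star :: "'a \<Rightarrow> 'a \<Rightarrow> 'a"
  assumes "tensor_algebra sV sT \<iota>"
    and "deshuffling_coproduct sT \<iota> \<Delta>"
    and "deshuffling_counit sT \<iota> \<epsilon>"
    and "bilinear_map sV sV sV starV"
    and "star_extension sT \<iota> \<Delta> \<epsilon> starV star"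
  shows "(\<exists>\<phi>. hopf_isomorphism sT (*) 1 \<Delta> \<epsilon> sT (circ_product sT \<Delta> star) 1 \<Delta> \<epsilon> \<phi> \<and>
            (\<forall>xs. \<phi> (prod_list (map \<iota> xs)) = foldr (circ_product sT \<Delta> star) (map \<iota> xs) 1)) \<and>
         (\<forall>f\<in>free_lie sT \<iota>. \<forall>g. star f g \<in> free_lie sT \<iota>) \<and>
         post_lie_algebra_on sT (free_lie sT \<iota>) commutator star \<and>
         (\<exists>\<psi>. lie_isomorphism_on sT (free_lie sT \<iota>) (second_bracket commutator star)
                sT (free_lie sT \<iota>) commutator \<psi>)"
proof -
  interpret post_lie_tensor sV sT \<iota> \<Delta> \<epsilon> starV star
    using assms by (simp add: post_lie_tensor_def post_lie_tensor_axioms_def)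
  show ?thesis
    using hopf_isomorphism_phi phi_word star_mem_Lie post_lie lie_isomorphism_phi_inv by blast
qed

end
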